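(* Let $(R,\mathfrak{m},k)$ be a one-dimensional Cohen-Macaulay local ring with infinite residue field $k$. Let $I$ be an Ulrich ideal of $R$. If $I^2\neq I(I:_R\mathfrak{m})$, then $I$ is Burch.
   Context: Local rings are commutative and Noetherian. Let $(R,\mathfrak{m},k)$ be a one-dimensional Cohen-Macaulay local ring. An $\mathfrak{m}$-primary ideal $I$ is Ulrich (as an $R$-module) if $\mu(I)=e(R)$, where $\mu(I)$ is the minimal number of generators of $I$ and $e(R)$ is the Hilbert-Samuel multiplicity of $R$; when $k$ is infinite this is equivalent to $xI=\mathfrak{m}I$ for some $x\in\mathfrak{m}$. An ideal $I$ of a local ring $(R,\mathfrak{m})$ is Burch if $\mathfrak{m}I\neq\mathfrak{m}(I:_R\mathfrak{m})$. *)

theory Defs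
  imports Complex_Main "HOL-Library.Extended_Nat" "HOL-Algebra.Algebra"
begin

locale noetherian_local_ring = noetherian_ring R + cring R
  for R (structure) and \<mm> +
  assumes maximal: "maximalideal \<mm> R"
    and unique_maximal: "maximalideal J R \<Longrightarrow> J = \<mm>"

text \<open>Supremum of the lengths \<open>n\<close> of strict chains \<open>C 0 \<subset> C 1 \<subset> \<dots> \<subset> C n\<close> of sets satisfying \<open>P\<close>.\<close>

definition chain_length :: "('a set \<Rightarrow> bool) \<Rightarrow> enat"
  where "chain_length P =
    Sup {enat n | n. \<exists>C. (\<forall>i\<le>n. P (C i)) \<and> (\<forall>i<n. C i \<subset> C (Suc i))}"

definition krull_dim :: "('a, 'b) ring_scheme \<Rightarrow> enat"
  where "krull_dim R = chain_length (\<lambda>P. primeideal P R)"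

text \<open>The length of a commutative ring as a module over itself. For an ideal \<open>J\<close> of \<open>R\<close>, the
  \<open>R\<close>-submodules of \<open>R/J\<close> are the ideals of the ring \<open>R/J\<close>, so \<open>ring_length (R Quot J)\<close> is also the
  length of the \<open>R\<close>-module \<open>R/J\<close>.\<close>

definition ring_length :: "('a, 'b) ring_scheme \<Rightarrow> enat"
  where "ring_length R = chain_length (\<lambda>J. ideal J R)"

definition regular_sequence :: "('a, 'b) ring_scheme \<Rightarrow> 'a list \<Rightarrow> bool"
  where "regular_sequence R xs \<longleftrightarrow>
    set xs \<subseteq> carrier R \<and> Idl\<^bsub>R\<^esub> (set xs) \<noteq> carrier R \<and>
    (\<forall>i<length xs. \<forall>a\<in>carrier R.
       xs ! i \<otimes>\<^bsub>R\<^esub> a \<in> Idl\<^bsub>R\<^esub> (set (take i xs)) \<longrightarrow> a \<in> Idl\<^bsub>R\<^esub> (set (take i xs)))"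

definition depth :: "('a, 'b) ring_scheme \<Rightarrow> 'a set \<Rightarrow> enat"
  where "depth R \<mm> = Sup {enat (length xs) | xs. set xs \<subseteq> \<mm> \<and> regular_sequence R xs}"

locale cohen_macaulay_local_ring = noetherian_local_ring +
  assumes depth_eq_dim: "depth R \<mm> = krull_dim R"

text \<open>\<open>e(R)\<close> is the limit of \<open>d! \<cdot> \<ell>(R/\<mm>\<^sup>n) / n\<^sup>d\<close>, where \<open>d = dim R\<close>. For a Noetherian local
  ring \<open>d\<close> and the lengths are finite and the limit exists. The power \<open>\<mm>\<^sup>n\<close> is taken in the
  monoid of ideals, whose unit is the ideal \<open>R\<close>.\<close>

definition multiplicity_HS :: "('a, 'b) ring_scheme \<Rightarrow> 'a set \<Rightarrow> real"
  where "multiplicity_HS R \<mm> =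
    (let d = the_enat (krull_dim R)
     in lim (\<lambda>n. fact d * real (the_enat (ring_length (R Quot (\<mm> [^]\<^bsub>ideals_set R\<^esub> n)))) / real n ^ d))"

definition min_generators :: "('a, 'b) ring_scheme \<Rightarrow> 'a set \<Rightarrow> nat"
  where "min_generators R I =
    (LEAST n. \<exists>A\<subseteq>carrier R. finite A \<and> card A = n \<and> I = Idl\<^bsub>R\<^esub> A)"

definition radical :: "('a, 'b) ring_scheme \<Rightarrow> 'a set \<Rightarrow> 'a set"
  where "radical R I = {a \<in> carrier R. \<exists>n::nat. a [^]\<^bsub>R\<^esub> n \<in> I}"

definition primary_ideal :: "('a, 'b) ring_scheme \<Rightarrow> 'a set \<Rightarrow> bool"
  where "primary_ideal R I \<longleftrightarrow> ideal I R \<and> I \<noteq> carrier R \<and>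
    (\<forall>a\<in>carrier R. \<forall>b\<in>carrier R. a \<otimes>\<^bsub>R\<^esub> b \<in> I \<longrightarrow> a \<in> I \<or> b \<in> radical R I)"

definition ulrich_ideal :: "('a, 'b) ring_scheme \<Rightarrow> 'a set \<Rightarrow> 'a set \<Rightarrow> bool"
  where "ulrich_ideal R \<mm> I \<longleftrightarrow>
    primary_ideal R I \<and> radical R I = \<mm> \<and> real (min_generators R I) = multiplicity_HS R \<mm>"

definition colon_ideal :: "('a, 'b) ring_scheme \<Rightarrow> 'a set \<Rightarrow> 'a set \<Rightarrow> 'a set"
  where "colon_ideal R I J = {a \<in> carrier R. \<forall>b\<in>J. a \<otimes>\<^bsub>R\<^esub> b \<in> I}"

definition burch_ideal :: "('a, 'b) ring_scheme \<Rightarrow> 'a set \<Rightarrow> 'a set \<Rightarrow> bool"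
  where "burch_ideal R \<mm> I \<longleftrightarrow> ideal I R \<and> \<mm> \<cdot>\<^bsub>R\<^esub> I \<noteq> \<mm> \<cdot>\<^bsub>R\<^esub> colon_ideal R I \<mm>"

end

theory Submission
  imports Defs
begin

no_notation Sum_Type.Plus (infixr \<open><+>\<close> 65)

text \<open>
  The theorem rests on an element \<open>y \<in> \<mm>\<close> with \<open>yI = \<mm>I\<close> that is a nonzerodivisor. Given such a \<open>y\<close>,
  suppose that \<open>I\<close> is not Burch and put \<open>J = I : \<mm>\<close>. Then \<open>yJ \<subseteq> \<mm>J = \<mm>I = yI\<close>, and cancelling \<open>y\<close>
  gives \<open>J = I\<close>, so that \<open>I\<^sup>2 = IJ\<close>, contrary to hypothesis
  (\<open>burch_ideal_if_max_prod_principal\<close>).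

  To find \<open>y\<close>, it is enough to have a nonzerodivisor \<open>y \<in> \<mm>\<close> such that \<open>R/yR\<close> has length \<open>e(R)\<close>. Indeed,
  additivity of length shows that \<open>I/yI\<close> then has length \<open>e(R)\<close> too, while \<open>I/\<mm>I\<close> has at least length
  \<open>\<mu>(I)\<close> by Nakayama's lemma. Since \<open>\<mu>(I) = e(R)\<close> for an Ulrich ideal, \<open>yI \<subseteq> \<mm>I\<close> is an equality
  (\<open>ulrich_ideal_max_prod\<close>).

  Every nonzerodivisor \<open>y\<close> that is a principal reduction of \<open>\<mm>\<close>, in the sense that
  \<open>\<mm>\<^sup>r\<^sup>+\<^sup>1 = y\<mm>\<^sup>r\<close> for some \<open>r\<close>, has this property: the quotients \<open>\<mm>\<^sup>n/\<mm>\<^sup>n\<^sup>+\<^sup>1\<close> with \<open>n \<ge> r\<close>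
  all have the length of \<open>R/yR\<close>, which is therefore the slope of the Hilbert-Samuel function
  (\<open>multiplicity_eq_quot_length\<close>). To see that a reduction exists, take a nonzerodivisor \<open>x \<in> \<mm>\<close>.
  Dimension one makes the length \<open>b\<close> of \<open>R/xR\<close> finite, and \<open>\<mm>\<^sup>n/\<mm>\<^sup>n\<^sup>+\<^sup>1\<close> has dimension at most \<open>b\<close>
  for every \<open>n\<close>. By the theorem of Eakin and Sathaye, \<open>\<mm>\<^sup>n = y\<mm>\<^sup>n\<^sup>-\<^sup>1\<close> for some \<open>y \<in> \<mm>\<close> as soon as
  \<open>n \<ge> 1\<close> and \<open>\<mm>\<^sup>n/\<mm>\<^sup>n\<^sup>+\<^sup>1\<close> has dimension at most \<open>n\<close> (\<open>exists_principal_reduction\<close>). Such a \<open>y\<close>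
  divides a power of \<open>x\<close> and so is a nonzerodivisor.

  The proof of the latter is an induction (\<open>exists_linear_cover\<close>) whose step must satisfy finitely many
  surjectivity conditions with a single element. This is where the residue field has to be infinite:
  if \<open>y\<close> satisfies such a condition, then so does \<open>sy + z\<close> for all but finitely many residue classes
  of \<open>s\<close>, because the exceptions are eigenvalues of an operator on a finite-dimensional space
  (\<open>finite_not_covers\<close>).
\<close>

section \<open>Lengths of chains\<close>

lemma chain_lengthI:
  assumes "\<And>i. i \<le> n \<Longrightarrow> P (C i)" "\<And>i. i < n \<Longrightarrow> C i \<subset> C (Suc i)"
  shows "enat n \<le> chain_length P"
  unfolding chain_length_def by (rule Sup_upper) (use assms in blast)

text \<open>The supremum in \<open>chain_length\<close> may be infinite, but a finite lower bound is always attained by a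
  chain of exactly that length, since initial segments of chains are chains.\<close>

lemma chain_length_ge_iff:
  assumes "P Z"
  shows "enat n \<le> chain_length P \<longleftrightarrow>
    (\<exists>C. (\<forall>i\<le>n. P (C i)) \<and> (\<forall>i<n. C i \<subset> C (Suc i)))"
proof
  assume n: "enat n \<le> chain_length P"
  show "\<exists>C. (\<forall>i\<le>n. P (C i)) \<and> (\<forall>i<n. C i \<subset> C (Suc i))"
  proof (cases n)
    case 0
    then show ?thesis using assms by (intro exI[of _ "\<lambda>_. Z"]) auto
  next
    case (Suc k)
    then have "enat k < chain_length P" using n by (metis enat_ord_simps(2) lessI order_less_le_trans)
    then obtain l C where l: "k < l" and C: "\<forall>i\<le>l. P (C i)" "\<forall>i<l. C i \<subset> C (Suc i)"
      unfolding chain_length_def less_Sup_iff by auto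
    then show ?thesis using Suc by (intro exI[of _ C]) auto
  qed
next
  assume "\<exists>C. (\<forall>i\<le>n. P (C i)) \<and> (\<forall>i<n. C i \<subset> C (Suc i))"
  then obtain C where "\<forall>i\<le>n. P (C i)" "\<forall>i<n. C i \<subset> C (Suc i)" by blast
  then show "enat n \<le> chain_length P" by (intro chain_lengthI[of n P C]) auto
qed

lemma enat_leI:
  assumes "\<And>n. enat n \<le> x \<Longrightarrow> enat n \<le> y"
  shows "x \<le> y"
proof (cases x)
  case infinity
  show ?thesis
  proof (cases y)
    case (enat k)
    then show ?thesis using assms[of "Suc k"] infinity by simp
  qed simp
qed (use assms in auto)

lemma chain_length_mono:
  assumes "\<And>Z. P Z \<Longrightarrow> Q (f Z)"
    and "\<And>Z Y. P Z \<Longrightarrow> P Y \<Longrightarrow> Z \<subset> Y \<Longrightarrow> f Z \<subset> f Y"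
  shows "chain_length P \<le> chain_length Q"
proof (cases "\<exists>Z. P Z")
  case True
  then obtain Z where Z: "P Z" ..
  show ?thesis
  proof (rule enat_leI)
    fix n assume "enat n \<le> chain_length P"
    then obtain C where "\<forall>i\<le>n. P (C i)" "\<forall>i<n. C i \<subset> C (Suc i)"
      unfolding chain_length_ge_iff[of P Z n, OF Z] by blast
    then show "enat n \<le> chain_length Q"
      by (intro chain_lengthI[where C="\<lambda>i. f (C i)"]) (simp_all add: assms)
  qed
next
  case False
  then have "chain_length P = 0" by (auto simp: chain_length_def bot_enat_def[symmetric])
  then show ?thesis by simp
qed

lemma enat_le_addE:
  assumes "enat n \<le> x + y"
  obtains a b where "n = a + b" "enat a \<le> x" "enat b \<le> y"
proof (cases "enat n \<le> x")
  case True
  then show ?thesis by (intro that[of n 0]) (auto simp: zero_enat_def[symmetric])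
next
  case False
  then obtain a where a: "x = enat a" "a < n" by (cases x) auto
  with assms have "enat (n - a) \<le> y" by (cases y) auto
  with a show ?thesis by (intro that[of a "n - a"]) auto
qed

section \<open>Lengths of ideal quotients\<close>

context ring
begin

lemma set_addI: "a \<in> I \<Longrightarrow> b \<in> J \<Longrightarrow> a \<oplus> b \<in> I <+> J"
  by (auto simp: set_add_def')

lemma set_addE:
  assumes "c \<in> I <+> J"
  obtains a b where "a \<in> I" "b \<in> J" "c = a \<oplus> b"
  using assms by (auto simp: set_add_def')

lemma ideal_subset: "ideal I R \<Longrightarrow> I \<subseteq> carrier R"
  by (simp add: additive_subgroup.a_subset ideal.axioms(1))

lemma ideal_zero: "ideal I R \<Longrightarrow> \<zero> \<in> I"
  by (simp add: additive_subgroup.zero_closed ideal.axioms(1))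

lemma ideal_add: "ideal I R \<Longrightarrow> a \<in> I \<Longrightarrow> b \<in> I \<Longrightarrow> a \<oplus> b \<in> I"
  by (simp add: additive_subgroup.a_closed ideal.axioms(1))

lemma ideal_diff: "ideal I R \<Longrightarrow> a \<in> I \<Longrightarrow> b \<in> I \<Longrightarrow> a \<ominus> b \<in> I"
  unfolding a_minus_def by (simp add: additive_subgroup.a_inv_closed ideal.axioms(1) ideal_add)

lemma ideal_diff_cancel:
  assumes I: "ideal I R" and a: "a \<in> carrier R" and b: "b \<in> I" and ab: "a \<oplus> b \<in> I"
  shows "a \<in> I"
proof -
  have "a = (a \<oplus> b) \<ominus> b"
    using a ideal.Icarr[OF I b] by algebra
  then show ?thesis using ideal_diff[OF I ab b] by simp
qed

lemma set_add_upper1: "ideal I R \<Longrightarrow> ideal J R \<Longrightarrow> I \<subseteq> I <+> J"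
  using set_addI[OF _ ideal_zero] by (metis ideal.Icarr r_zero subsetI)

lemma set_add_upper2: "ideal I R \<Longrightarrow> ideal J R \<Longrightarrow> J \<subseteq> I <+> J"
  using set_addI[OF ideal_zero] by (metis ideal.Icarr l_zero subsetI)

lemma set_add_least: "ideal K R \<Longrightarrow> I \<subseteq> K \<Longrightarrow> J \<subseteq> K \<Longrightarrow> I <+> J \<subseteq> K"
  by (auto elim!: set_addE intro: ideal_add)

lemma ideal_Int: "ideal I R \<Longrightarrow> ideal J R \<Longrightarrow> ideal (I \<inter> J) R"
  by (rule i_intersect)

lemma ideal_prod_mono: "I \<subseteq> I' \<Longrightarrow> J \<subseteq> J' \<Longrightarrow> I \<cdot> J \<subseteq> I' \<cdot> J'"
proof
  fix a assume "I \<subseteq> I'" "J \<subseteq> J'" "a \<in> I \<cdot> J"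
  from this(3,1,2) show "a \<in> I' \<cdot> J'"
    by induction (auto intro: ideal_prod.intros)
qed

lemma ideal_prod_least:
  assumes "ideal K R" "\<And>a b. a \<in> I \<Longrightarrow> b \<in> J \<Longrightarrow> a \<otimes> b \<in> K"
  shows "I \<cdot> J \<subseteq> K"
proof
  fix a assume "a \<in> I \<cdot> J"
  then show "a \<in> K" by induction (auto intro: assms ideal_add)
qed

text \<open>For ideals \<open>K \<subseteq> L\<close> this is the length of the module \<open>L/K\<close>, whose submodules correspond to the
  ideals between \<open>K\<close> and \<open>L\<close>. Phrased in terms of this interval, every fact about lengths becomes
  a statement about the modular lattice of ideals of \<open>R\<close>.\<close>

definition quot_length :: "'a set \<Rightarrow> 'a set \<Rightarrow> enat"
  where "quot_length K L = chain_length (\<lambda>J. ideal J R \<and> K \<subseteq> J \<and> J \<subseteq> L)"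

lemma quot_length_ge_iff:
  assumes "ideal K R" "K \<subseteq> L"
  shows "enat n \<le> quot_length K L \<longleftrightarrow>
    (\<exists>C. (\<forall>i\<le>n. ideal (C i) R \<and> K \<subseteq> C i \<and> C i \<subseteq> L) \<and> (\<forall>i<n. C i \<subset> C (Suc i)))"
  unfolding quot_length_def by (rule chain_length_ge_iff[where Z=K]) (use assms in auto)

text \<open>A chain of ideals between \<open>K\<close> and \<open>L\<close> can be continued by one between \<open>L\<close> and \<open>M\<close>.\<close>

lemma quot_length_superadditive:
  assumes "ideal K R" "ideal L R" "K \<subseteq> L" "L \<subseteq> M"
  shows "quot_length K L + quot_length L M \<le> quot_length K M"
proof (rule enat_leI)
  fix n assume "enat n \<le> quot_length K L + quot_length L M"
  then obtain a b where n: "n = a + b" and ab: "enat a \<le> quot_length K L" "enat b \<le> quot_length L M"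
    by (rule enat_le_addE)
  then obtain C D where
    C: "\<forall>i\<le>a. ideal (C i) R \<and> K \<subseteq> C i \<and> C i \<subseteq> L" "\<forall>i<a. C i \<subset> C (Suc i)" and
    D: "\<forall>i\<le>b. ideal (D i) R \<and> L \<subseteq> D i \<and> D i \<subseteq> M" "\<forall>i<b. D i \<subset> D (Suc i)"
    using assms by (auto simp: quot_length_ge_iff)
  define E where "E i = (if i \<le> a then C i else D (i - a))" for i
  have "ideal (E i) R \<and> K \<subseteq> E i \<and> E i \<subseteq> M" if "i \<le> n" for i
  proof (cases "i \<le> a")
    case True
    then have "ideal (C i) R" "K \<subseteq> C i" "C i \<subseteq> M" using C(1) assms(4) by auto
    then show ?thesis using True unfolding E_def by simp
  next
    case False
    have "i - a \<le> b" using that n by auto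
    with D(1) have "ideal (D (i - a)) R" "K \<subseteq> D (i - a)" "D (i - a) \<subseteq> M" using assms(3) by blast+
    then show ?thesis using False unfolding E_def by simp
  qed
  moreover have "E i \<subset> E (Suc i)" if "i < n" for i
  proof -
    consider "i < a" | "i = a" | "i > a" by linarith
    then show ?thesis
    proof cases
      case 1
      then show ?thesis using C(2) unfolding E_def by auto
    next
      case 2
      then have "C a \<subseteq> D 0" "D 0 \<subset> D 1" using C(1) D that n by (auto, blast+)
      then show ?thesis using 2 unfolding E_def by auto
    next
      case 3
      then have "Suc i - a = Suc (i - a)" "i - a < b" using that n by auto
      then show ?thesis using 3 D(2) unfolding E_def by auto
    qed
  qed
  ultimately show "enat n \<le> quot_length K M"
    unfolding quot_length_def by (rule chain_lengthI)
qed

lemma quot_length_mono: "L \<subseteq> M \<Longrightarrow> quot_length K L \<le> quot_length K M"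
  unfolding quot_length_def by (rule chain_length_mono[where f=id]) auto

lemma quot_length_antimono: "K \<subseteq> L \<Longrightarrow> quot_length L M \<le> quot_length K M"
  unfolding quot_length_def by (rule chain_length_mono[where f=id]) auto

lemma quot_length_psubset:
  assumes "ideal K R" "ideal L R" "ideal M R" "K \<subseteq> L" "L \<subset> M"
  shows "quot_length K L + 1 \<le> quot_length K M"
proof -
  have "enat 1 \<le> quot_length L M"
    unfolding quot_length_def
    by (rule chain_lengthI[where C="\<lambda>i. if i = 0 then L else M"]) (use assms in auto)
  then have "quot_length K L + 1 \<le> quot_length K L + quot_length L M"
    by (intro add_left_mono) (simp add: one_enat_def)
  also have "\<dots> \<le> quot_length K M"
    by (rule quot_length_superadditive) (use assms in auto)
  finally show ?thesis .
qed

lemma quot_length_eqD: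
  assumes "ideal K R" "ideal L R" "ideal M R" "K \<subseteq> L" "L \<subseteq> M"
    and "quot_length K M \<le> quot_length K L" "quot_length K L < \<infinity>"
  shows "L = M"
proof (rule ccontr)
  assume "L \<noteq> M"
  then have "quot_length K L + 1 \<le> quot_length K M"
    using assms by (intro quot_length_psubset) auto
  then have "quot_length K L + 1 \<le> quot_length K L" using assms by (meson order_trans)
  then show False using assms(7) by (cases "quot_length K L") (auto simp: one_enat_def)
qed

text \<open>The modular law in cancellation form. It prevents a strict inclusion from becoming invisible both
  below and above \<open>L\<close>.\<close>

lemma modular_eq:
  assumes Z: "ideal Z R" and Y: "ideal Y R" and L: "ideal L R" and "Z \<subseteq> Y"
    and eq: "Z \<inter> L = Y \<inter> L" "Z <+> L = Y <+> L"
  shows "Z = Y"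
proof
  show "Y \<subseteq> Z"
  proof
    fix y assume y: "y \<in> Y"
    then have "y \<in> Z <+> L" using eq(2) set_add_upper1[OF Y L] by auto
    then obtain x l where xl: "x \<in> Z" "l \<in> L" "y = x \<oplus> l" by (rule set_addE)
    have c: "x \<in> carrier R" "l \<in> carrier R" using ideal.Icarr[OF Z xl(1)] ideal.Icarr[OF L xl(2)] by auto
    have "l \<oplus> x \<in> Y" using xl(3) y a_comm[OF c] by simp
    then have "l \<in> Y" using ideal_diff_cancel[OF Y c(2)] xl(1) \<open>Z \<subseteq> Y\<close> by blast
    then have "l \<in> Z" using xl eq(1) by blast
    then show "y \<in> Z" using xl Z ideal_add by auto
  qed
qed fact

text \<open>Each step of a chain \<open>C\<close> between \<open>K\<close> and \<open>M\<close> is strict after intersecting with \<open>L\<close> or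
  after adding \<open>L\<close>.\<close>

lemma quot_length_add:
  assumes K: "ideal K R" and L: "ideal L R" and M: "ideal M R" and sub: "K \<subseteq> L" "L \<subseteq> M"
  shows "quot_length K M = quot_length K L + quot_length L M"
proof (rule antisym)
  show "quot_length K M \<le> quot_length K L + quot_length L M"
  proof (rule enat_leI)
    fix n assume "enat n \<le> quot_length K M"
    then obtain C where C: "\<forall>i\<le>n. ideal (C i) R \<and> K \<subseteq> C i \<and> C i \<subseteq> M"
        and strict: "\<forall>i<n. C i \<subset> C (Suc i)"
      using K sub by (auto simp: quot_length_ge_iff)
    define f where "f i = quot_length K (C i \<inter> L) + quot_length L (C i <+> L)" for i
    have step: "f i + 1 \<le> f (Suc i)" if "i < n" for i
    proof -
      have i: "ideal (C i) R" "ideal (C (Suc i)) R" "K \<subseteq> C i" "C i \<subset> C (Suc i)"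
        using C strict that by auto
      have ideals: "ideal (C i \<inter> L) R" "ideal (C (Suc i) \<inter> L) R"
          "ideal (C i <+> L) R" "ideal (C (Suc i) <+> L) R"
        using i L by (auto intro: ideal_Int add_ideals)
      have le: "C i \<inter> L \<subseteq> C (Suc i) \<inter> L" "C i <+> L \<subseteq> C (Suc i) <+> L"
        using i by (auto elim!: set_addE intro: set_addI)
      then consider "C i \<inter> L \<subset> C (Suc i) \<inter> L" | "C i <+> L \<subset> C (Suc i) <+> L"
        using modular_eq[OF i(1,2) L] i(4) by auto
      then show ?thesis
      proof cases
        case 1
        then have "quot_length K (C i \<inter> L) + 1 \<le> quot_length K (C (Suc i) \<inter> L)"
          using K ideals i sub by (intro quot_length_psubset) auto
        from add_mono[OF this quot_length_mono[OF le(2), of L]] show ?thesis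
          unfolding f_def by (simp add: ac_simps)
      next
        case 2
        then have "quot_length L (C i <+> L) + 1 \<le> quot_length L (C (Suc i) <+> L)"
          using L ideals set_add_upper2[OF i(1) L] by (intro quot_length_psubset) auto
        from add_mono[OF quot_length_mono[OF le(1), of K] this] show ?thesis
          unfolding f_def by (simp add: ac_simps)
      qed
    qed
    have "enat i \<le> f i" if "i \<le> n" for i
      using that
    proof (induction i)
      case (Suc i)
      then have "enat i + 1 \<le> f i + 1" by (intro add_right_mono) auto
      also have "\<dots> \<le> f (Suc i)" using step Suc by auto
      finally show ?case by (simp add: one_enat_def)
    qed (simp add: zero_enat_def[symmetric])
    then have "enat n \<le> f n" by simp
    also have "C n \<inter> L \<subseteq> L" "C n <+> L \<subseteq> M"
      using C sub set_add_least[OF M] by auto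
    then have "f n \<le> quot_length K L + quot_length L M"
      unfolding f_def by (intro add_mono quot_length_mono)
    finally show "enat n \<le> quot_length K L + quot_length L M" .
  qed
qed (rule quot_length_superadditive; fact)

lemma ring_length_Quot:
  assumes I: "ideal I R"
  shows "ring_length (R Quot I) = quot_length I (carrier R)"
proof -
  have inv: "\<Union> ((+>) I ` J) = J" if "ideal J R" "I \<subseteq> J" for J
    using ideal_incl_iff[OF I that(1)] that by blast
  have lift: thesis if "ideal Z (R Quot I)"
      "\<And>J. ideal J R \<Longrightarrow> I \<subseteq> J \<Longrightarrow> Z = (+>) I ` J \<Longrightarrow> thesis" for Z thesis
  proof -
    have "Z \<in> (\<lambda>J. (+>) I ` J) ` {J. ideal J R \<and> I \<subseteq> J}"
      using quot_ideal_correspondence[OF I] that(1) by (simp add: bij_betw_def)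
    then show thesis using that(2) by auto
  qed
  have inv': "(+>) I ` \<Union> Z = Z" if Zq: "ideal Z (R Quot I)" for Z
  proof -
    obtain J where J: "ideal J R" "I \<subseteq> J" "Z = (+>) I ` J"
      by (rule lift[OF Zq])
    then show ?thesis using inv[OF J(1,2)] by simp
  qed
  have up: "ideal (\<Union> Z) R \<and> I \<subseteq> \<Union> Z" if Zq: "ideal Z (R Quot I)" for Z
  proof -
    obtain J where J: "ideal J R" "I \<subseteq> J" "Z = (+>) I ` J"
      by (rule lift[OF Zq])
    then show ?thesis using inv[OF J(1,2)] by simp
  qed
  show ?thesis
  proof (rule antisym)
    show "ring_length (R Quot I) \<le> quot_length I (carrier R)"
      unfolding ring_length_def quot_length_def
    proof (rule chain_length_mono[where f=Union])
      show "ideal (\<Union> Z) R \<and> I \<subseteq> \<Union> Z \<and> \<Union> Z \<subseteq> carrier R" if "ideal Z (R Quot I)" for Z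
        using up[OF that] ideal_subset by blast
      show "\<Union> Z \<subset> \<Union> Y" if "ideal Z (R Quot I)" "ideal Y (R Quot I)" "Z \<subset> Y" for Z Y
      proof -
        have "\<Union> Z \<subseteq> \<Union> Y" using that(3) by blast
        moreover have "\<Union> Z \<noteq> \<Union> Y"
          using inv'[OF that(1)] inv'[OF that(2)] that(3) by (metis psubsetE subset_refl)
        ultimately show ?thesis by blast
      qed
    qed
    show "quot_length I (carrier R) \<le> ring_length (R Quot I)"
      unfolding ring_length_def quot_length_def
    proof (rule chain_length_mono[where f="\<lambda>J. (+>) I ` J"])
      show "ideal ((+>) I ` J) (R Quot I)" if "ideal J R \<and> I \<subseteq> J \<and> J \<subseteq> carrier R" for J
        using that I ring_ideal_imp_quot_ideal by auto
      show "(+>) I ` Z \<subset> (+>) I ` Y"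
        if "ideal Z R \<and> I \<subseteq> Z \<and> Z \<subseteq> carrier R" "ideal Y R \<and> I \<subseteq> Y \<and> Y \<subseteq> carrier R" "Z \<subset> Y" for Z Y
      proof -
        have "(+>) I ` Z \<subseteq> (+>) I ` Y" using that(3) by blast
        moreover have "(+>) I ` Z \<noteq> (+>) I ` Y"
          using inv[of Z] inv[of Y] that by (metis psubsetE subset_refl)
        ultimately show ?thesis by blast
      qed
    qed
  qed
qed

end

context cring
begin

lemma ideal_by_closure:
  assumes "H \<subseteq> carrier R" "\<zero> \<in> H" "\<And>a b. a \<in> H \<Longrightarrow> b \<in> H \<Longrightarrow> a \<oplus> b \<in> H"
    and mult: "\<And>r a. r \<in> carrier R \<Longrightarrow> a \<in> H \<Longrightarrow> r \<otimes> a \<in> H"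
  shows "ideal H R"
proof (rule idealI)
  show "subgroup H (add_monoid R)"
  proof (rule add.subgroupI)
    fix a assume a: "a \<in> H"
    have "\<ominus> a = (\<ominus> \<one>) \<otimes> a" using a assms(1) by (simp add: l_minus subsetD)
    then show "\<ominus> a \<in> H" using mult[OF _ a] by simp
  qed (use assms in auto)
  fix a r assume a: "a \<in> H" and r: "r \<in> carrier R"
  show "r \<otimes> a \<in> H" using mult a r by auto
  then show "a \<otimes> r \<in> H" using m_comm[of a r] a r assms(1) by auto
qed (rule ring_axioms)

lemma mem_scaleI: "v \<in> V \<Longrightarrow> u \<otimes> v \<in> u <# V"
  by (auto simp: l_coset_def)

lemma mem_scaleE:
  assumes "c \<in> u <# V"
  obtains v where "v \<in> V" "c = u \<otimes> v"
  using assms by (auto simp: l_coset_def)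

lemma ideal_scale:
  assumes V: "ideal V R" and u: "u \<in> carrier R"
  shows "ideal (u <# V) R"
proof (rule ideal_by_closure)
  note [simp] = ideal.Icarr[OF V]
  show "u <# V \<subseteq> carrier R" using u by (auto elim!: mem_scaleE)
  show "\<zero> \<in> u <# V" using mem_scaleI[OF ideal_zero[OF V], of u] u by simp
  fix a assume "a \<in> u <# V"
  then obtain v where v: "v \<in> V" "a = u \<otimes> v" by (rule mem_scaleE)
  show "r \<otimes> a \<in> u <# V" if "r \<in> carrier R" for r
    using mem_scaleI[OF ideal.I_l_closed[OF V v(1) that], of u] v u that by (simp add: m_lcomm)
  fix b assume "b \<in> u <# V"
  then obtain v' where v': "v' \<in> V" "b = u \<otimes> v'" by (rule mem_scaleE)
  show "a \<oplus> b \<in> u <# V"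
    using mem_scaleI[OF ideal_add[OF V v(1) v'(1)], of u] v v' u by (simp add: r_distr)
qed

lemma scale_subset: "ideal V R \<Longrightarrow> u \<in> carrier R \<Longrightarrow> u <# V \<subseteq> V"
  by (auto elim!: mem_scaleE simp: ideal.I_l_closed)

lemma scale_mono: "V \<subseteq> W \<Longrightarrow> u <# V \<subseteq> u <# W"
  by (auto simp: l_coset_def)

lemma scale_scale:
  "V \<subseteq> carrier R \<Longrightarrow> u \<in> carrier R \<Longrightarrow> w \<in> carrier R \<Longrightarrow> u <# (w <# V) = (u \<otimes> w) <# V"
  unfolding l_coset_def by (auto simp: m_assoc subset_iff)

lemma scale_one: "V \<subseteq> carrier R \<Longrightarrow> \<one> <# V = V"
  unfolding l_coset_def by (force simp: subset_iff)

lemma scale_prod: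
  assumes I: "ideal I R" and V: "ideal V R" and u: "u \<in> carrier R"
  shows "u <# (I \<cdot> V) = I \<cdot> (u <# V)"
proof
  show "I \<cdot> (u <# V) \<subseteq> u <# (I \<cdot> V)"
  proof (rule ideal_prod_least)
    show "ideal (u <# (I \<cdot> V)) R" using assms by (simp add: ideal_scale ideal_prod_is_ideal)
    fix a b assume a: "a \<in> I" and "b \<in> u <# V"
    then obtain v where v: "v \<in> V" "b = u \<otimes> v" by (auto elim: mem_scaleE)
    have "a \<otimes> b = u \<otimes> (a \<otimes> v)"
      using v u ideal.Icarr[OF I a] ideal.Icarr[OF V v(1)] by (simp add: m_lcomm)
    then show "a \<otimes> b \<in> u <# (I \<cdot> V)" by (simp add: mem_scaleI ideal_prod.prod a v)
  qed
  have "u \<otimes> c \<in> I \<cdot> (u <# V)" if "c \<in> I \<cdot> V" for c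
    using that
  proof induction
    case (prod i j)
    then have "u \<otimes> (i \<otimes> j) = i \<otimes> (u \<otimes> j)"
      using u ideal.Icarr[OF I] ideal.Icarr[OF V] by (simp add: m_lcomm)
    then show ?case using prod by (simp add: ideal_prod.prod mem_scaleI)
  next
    case (sum s t)
    then have "u \<otimes> (s \<oplus> t) = u \<otimes> s \<oplus> u \<otimes> t"
      using u ideal_prod_in_carrier[OF I V] by (auto simp: r_distr subset_iff)
    then show ?case using sum by (simp add: ideal_prod.sum)
  qed
  then show "u <# (I \<cdot> V) \<subseteq> I \<cdot> (u <# V)" by (auto elim!: mem_scaleE)
qed

lemma ideal_scale_vimage:
  assumes V: "ideal V R" and P: "ideal P R" and u: "u \<in> carrier R"
  shows "ideal {v \<in> V. u \<otimes> v \<in> P} R"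
  using ideal.Icarr[OF V] u ideal_zero[OF V] ideal_zero[OF P]
  by (intro ideal_by_closure)
    (auto simp: r_distr ideal_add[OF V] ideal_add[OF P] ideal.I_l_closed[OF V]
      ideal.I_l_closed[OF P] m_lcomm[of u])

text \<open>Multiplication by \<open>u\<close> induces an isomorphism of the quotient of \<open>V\<close> by its kernel modulo \<open>P\<close>
  onto the image of \<open>V\<close> modulo \<open>P\<close>.\<close>

lemma quot_length_scale:
  assumes V: "ideal V R" and P: "ideal P R" and u: "u \<in> carrier R"
  shows "quot_length P ((u <# V) <+> P) = quot_length {v \<in> V. u \<otimes> v \<in> P} V"
proof (rule antisym)
  have sV: "ideal (u <# V) R" using V u by (rule ideal_scale)
  note c = ideal.Icarr[OF V]
  let ?back = "\<lambda>Z. {v \<in> V. u \<otimes> v \<in> Z}"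
  show "quot_length P ((u <# V) <+> P) \<le> quot_length (?back P) V"
    unfolding quot_length_def
  proof (rule chain_length_mono[where f="?back"])
    fix Z assume Z: "ideal Z R \<and> P \<subseteq> Z \<and> Z \<subseteq> (u <# V) <+> P"
    then show "ideal (?back Z) R \<and> ?back P \<subseteq> ?back Z \<and> ?back Z \<subseteq> V"
      using ideal_scale_vimage[OF V _ u] by auto
    fix Y assume Y: "ideal Y R \<and> P \<subseteq> Y \<and> Y \<subseteq> (u <# V) <+> P" and "Z \<subset> Y"
    then obtain y where y: "y \<in> Y" "y \<notin> Z" by blast
    then have "y \<in> (u <# V) <+> P" using Y by blast
    then obtain a p where ap: "a \<in> u <# V" "p \<in> P" "y = a \<oplus> p" by (rule set_addE)
    then obtain v where v: "v \<in> V" "a = u \<otimes> v" by (auto elim: mem_scaleE)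
    have "a \<in> Y"
      using ideal_diff_cancel[of Y a p] Y ap y v c u by auto
    moreover have "a \<notin> Z" using y ap Z ideal_add[of Z a p] by auto
    ultimately have "v \<in> ?back Y" "v \<notin> ?back Z" using v by auto
    moreover have "?back Z \<subseteq> ?back Y" using \<open>Z \<subset> Y\<close> by blast
    ultimately show "?back Z \<subset> ?back Y" by blast
  qed
  let ?forth = "\<lambda>Z. (u <# Z) <+> P"
  show "quot_length (?back P) V \<le> quot_length P ((u <# V) <+> P)"
    unfolding quot_length_def
  proof (rule chain_length_mono[where f="?forth"])
    fix Z assume Z: "ideal Z R \<and> ?back P \<subseteq> Z \<and> Z \<subseteq> V"
    then have sZ: "ideal (u <# Z) R" "u <# Z \<subseteq> u <# V" using u ideal_scale scale_mono by auto
    show "ideal (?forth Z) R \<and> P \<subseteq> ?forth Z \<and> ?forth Z \<subseteq> ?forth V"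
      using sZ P set_add_upper2[OF sZ(1) P] by (auto simp: add_ideals elim!: set_addE intro: set_addI)
    fix Y assume Y: "ideal Y R \<and> ?back P \<subseteq> Y \<and> Y \<subseteq> V" and less: "Z \<subset> Y"
    then obtain y where y: "y \<in> Y" "y \<notin> Z" by blast
    have sY: "ideal (u <# Y) R" using Y u ideal_scale by auto
    have "u \<otimes> y \<in> ?forth Y"
      using set_add_upper1[OF sY P] mem_scaleI[OF y(1)] by blast
    moreover have "u \<otimes> y \<notin> ?forth Z"
    proof
      assume "u \<otimes> y \<in> ?forth Z"
      then obtain a p where ap: "a \<in> u <# Z" "p \<in> P" "u \<otimes> y = a \<oplus> p" by (rule set_addE)
      then obtain z where z: "z \<in> Z" "a = u \<otimes> z" by (auto elim: mem_scaleE)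
      have yz: "y \<in> V" "z \<in> V" using y z Y Z by auto
      have "u \<otimes> (y \<ominus> z) = p"
        using ap z c yz u ideal.Icarr[OF P ap(2)] by algebra
      then have "y \<ominus> z \<in> Z" using ideal_diff[OF V yz] ap(2) Z by auto
      then have "(y \<ominus> z) \<oplus> z \<in> Z" using z Z ideal_add by blast
      also have "(y \<ominus> z) \<oplus> z = y" using c yz by algebra
      finally show False using y by simp
    qed
    moreover have "?forth Z \<subseteq> ?forth Y"
      using less scale_mono[of Z Y u] by (auto elim!: set_addE intro: set_addI)
    ultimately show "?forth Z \<subset> ?forth Y" by blast
  qed
qed

text \<open>The special case of \<open>quot_length_scale\<close> in which the kernel modulo \<open>uK\<close> is \<open>K\<close> itself.\<close>

lemma quot_length_scale_nonzerodivisor: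
  assumes K: "ideal K R" and L: "ideal L R" and "K \<subseteq> L" and u: "u \<in> carrier R"
    and nzd: "\<And>a. a \<in> carrier R \<Longrightarrow> u \<otimes> a = \<zero> \<Longrightarrow> a = \<zero>"
  shows "quot_length (u <# K) (u <# L) = quot_length K L"
proof -
  have sK: "ideal (u <# K) R" and sL: "ideal (u <# L) R" using assms ideal_scale by auto
  have "(u <# L) <+> (u <# K) = u <# L"
    using set_add_upper1[OF sL sK] set_add_least[OF sL] scale_mono[OF \<open>K \<subseteq> L\<close>] by blast
  moreover have "{v \<in> L. u \<otimes> v \<in> u <# K} = K"
  proof
    show "{v \<in> L. u \<otimes> v \<in> u <# K} \<subseteq> K"
    proof
      fix v assume "v \<in> {v \<in> L. u \<otimes> v \<in> u <# K}"
      then obtain k where k: "v \<in> L" "k \<in> K" "u \<otimes> v = u \<otimes> k" by (auto elim: mem_scaleE)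
      have c: "v \<in> carrier R" "k \<in> carrier R" using k ideal.Icarr[OF L] ideal.Icarr[OF K] by auto
      have "u \<otimes> (v \<ominus> k) = u \<otimes> v \<ominus> u \<otimes> k" using c u by algebra
      then have "u \<otimes> (v \<ominus> k) = \<zero>" using k c u by simp
      then have "v \<ominus> k = \<zero>" using nzd c by simp
      then show "v \<in> K" using c k by simp
    qed
  qed (use \<open>K \<subseteq> L\<close> mem_scaleI in auto)
  ultimately show ?thesis using quot_length_scale[OF L sK u] by simp
qed

lemma mem_PIdlI: "r \<in> carrier R \<Longrightarrow> r \<otimes> a \<in> PIdl a"
  by (auto simp: cgenideal_def)

lemma mem_PIdlE:
  assumes "b \<in> PIdl a"
  obtains r where "r \<in> carrier R" "b = r \<otimes> a"
  using assms by (auto simp: cgenideal_def)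

lemma PIdl_subset: "ideal J R \<Longrightarrow> a \<in> J \<Longrightarrow> PIdl a \<subseteq> J"
  by (rule cgenideal_minimal)

lemma set_add_Idl_insert:
  assumes K: "ideal K R" and A: "A \<subseteq> carrier R" and a: "a \<in> carrier R"
  shows "K <+> Idl (insert a A) = (K <+> Idl A) <+> PIdl a"
proof -
  have i: "ideal (Idl A) R" "ideal (Idl (insert a A)) R" "ideal (PIdl a) R"
    using A a by (auto intro: genideal_ideal cgenideal_ideal)
  note j = add_ideals[OF K i(1)] add_ideals[OF K i(2)] add_ideals[OF add_ideals[OF K i(1)] i(3)]
  have sub: "insert a A \<subseteq> Idl (insert a A)" "A \<subseteq> Idl A"
    using A a by (auto intro: genideal_self[THEN subsetD])
  have "Idl A \<subseteq> Idl (insert a A)" "PIdl a \<subseteq> Idl (insert a A)"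
    using genideal_minimal[OF i(2)] PIdl_subset[OF i(2)] sub(1) by auto
  then have "(K <+> Idl A) <+> PIdl a \<subseteq> K <+> Idl (insert a A)"
    using set_add_upper1[OF K i(2)] set_add_upper2[OF K i(2)] by (intro set_add_least j(2)) auto
  moreover have "insert a A \<subseteq> (K <+> Idl A) <+> PIdl a"
    using sub(2) cgenideal_self[OF a] set_add_upper1[OF j(1) i(3)] set_add_upper2[OF j(1) i(3)]
      set_add_upper2[OF K i(1)] by auto
  then have "Idl (insert a A) \<subseteq> (K <+> Idl A) <+> PIdl a" using genideal_minimal j(3) by blast
  then have "K <+> Idl (insert a A) \<subseteq> (K <+> Idl A) <+> PIdl a"
    using set_add_upper1[OF j(1) i(3)] set_add_upper1[OF K i(1)] by (intro set_add_least j(3)) auto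
  ultimately show ?thesis by blast
qed

lemma Idl_empty: "Idl {} = {\<zero>}"
  using genideal_minimal[OF zeroideal, of "{}"] ideal_zero[OF genideal_ideal[of "{}"]] by auto

lemma set_add_zero: "ideal K R \<Longrightarrow> K <+> {\<zero>} = K"
  using ideal_subset by (auto simp: set_add_def' subset_iff)

end

section \<open>Noetherian local rings\<close>

context noetherian_ring
begin

text \<open>The ascending chain condition, in the form of a maximal element in every nonempty set of ideals.\<close>

lemma ideal_maximal_element:
  assumes "S \<noteq> {}" "\<And>J. J \<in> S \<Longrightarrow> ideal J R"
  obtains M where "M \<in> S" "\<And>J. J \<in> S \<Longrightarrow> M \<subseteq> J \<Longrightarrow> J = M"
proof -
  have "\<exists>M\<in>S. \<forall>J\<in>S. M \<subseteq> J \<longrightarrow> J = M"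
  proof (rule subset_Zorn_nonempty[OF assms(1)])
    fix C assume "C \<noteq> {}" "subset.chain S C"
    moreover have "S \<subseteq> {J. ideal J R}" using assms(2) by auto
    ultimately have "\<Union> C \<in> C"
      by (intro ideal_chain_is_trivial) (auto simp: subset.chain_def)
    then show "\<Union> C \<in> S" using \<open>subset.chain S C\<close> by (auto simp: subset.chain_def)
  qed
  then show thesis using that by blast
qed

end

context noetherian_local_ring
begin

lemma ideal_max: "ideal \<mm> R"
  using maximal by (rule maximalideal.axioms(1))

lemma max_subset: "\<mm> \<subseteq> carrier R"
  using ideal_max by (rule ideal_subset)

lemma one_notin_max: "\<one> \<notin> \<mm>"
  using maximalideal.I_notcarr[OF maximal] ideal.one_imp_carrier[OF ideal_max] by auto

lemma prime_max: "primeideal \<mm> R"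
  by (rule maximalideal_prime[OF maximal])

lemma proper_subset_max:
  assumes J: "ideal J R" "J \<noteq> carrier R"
  shows "J \<subseteq> \<mm>"
proof -
  obtain M where M: "M \<in> {M. ideal M R \<and> J \<subseteq> M \<and> M \<noteq> carrier R}"
      "\<And>K. K \<in> {M. ideal M R \<and> J \<subseteq> M \<and> M \<noteq> carrier R} \<Longrightarrow> M \<subseteq> K \<Longrightarrow> K = M"
    by (rule ideal_maximal_element[of "{M. ideal M R \<and> J \<subseteq> M \<and> M \<noteq> carrier R}"])
      (use J in auto)
  then have "maximalideal M R" by (intro maximalidealI) auto
  then show ?thesis using unique_maximal M(1) by auto
qed

lemma unit_iff_notin_max:
  assumes a: "a \<in> carrier R"
  shows "a \<in> Units R \<longleftrightarrow> a \<notin> \<mm>"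
proof
  assume "a \<notin> \<mm>"
  then have "PIdl a = carrier R"
    using proper_subset_max[OF cgenideal_ideal[OF a]] cgenideal_self[OF a] by blast
  then show "a \<in> Units R" using ideal_eq_carrier_iff[OF a] by simp
next
  assume u: "a \<in> Units R"
  show "a \<notin> \<mm>"
  proof
    assume "a \<in> \<mm>"
    then have "inv a \<otimes> a \<in> \<mm>" using ideal.I_l_closed[OF ideal_max] Units_inv_closed[OF u] by blast
    then show False using u one_notin_max by simp
  qed
qed

lemma ideal_unit_cancel:
  assumes J: "ideal J R" and s: "s \<in> Units R" and v: "v \<in> carrier R" and "s \<otimes> v \<in> J"
  shows "v \<in> J"
proof -
  have "inv s \<otimes> (s \<otimes> v) \<in> J" using ideal.I_l_closed[OF J assms(4) Units_inv_closed[OF s]] .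
  also have "inv s \<otimes> (s \<otimes> v) = v" using s v by (simp add: m_assoc[symmetric] Units_closed)
  finally show ?thesis .
qed

text \<open>Nakayama's lemma. A maximal ideal \<open>H\<close> among those with \<open>L \<subseteq> H \<subset> V\<close> has simple
  quotient \<open>V/H\<close>, so it contains \<open>\<mm>V\<close>.\<close>

lemma Nakayama:
  assumes V: "ideal V R" and K: "ideal K R" and le: "V \<subseteq> K <+> (\<mm> \<cdot> V)"
  shows "V \<subseteq> K"
proof (rule ccontr)
  assume "\<not> V \<subseteq> K"
  define L where "L = K \<inter> V"
  define S where "S = {H. ideal H R \<and> L \<subseteq> H \<and> H \<subset> V}"
  have mV: "ideal (\<mm> \<cdot> V) R" "\<mm> \<cdot> V \<subseteq> V"
    using ideal_prod_is_ideal[OF ideal_max V] ideal_prod_inter[OF ideal_max V] by auto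
  have "L \<in> S" using \<open>\<not> V \<subseteq> K\<close> V K unfolding S_def L_def by (auto intro: ideal_Int)
  then obtain H where H: "H \<in> S" and max: "\<And>J. J \<in> S \<Longrightarrow> H \<subseteq> J \<Longrightarrow> J = H"
    using ideal_maximal_element[of S] unfolding S_def by blast
  then have iH: "ideal H R" and LH: "L \<subseteq> H" and HV: "H \<subset> V" unfolding S_def by auto
  have mVH: "\<mm> \<cdot> V \<subseteq> H"
  proof (rule ideal_prod_least[OF iH], rule ccontr)
    fix a v assume a: "a \<in> \<mm>" and v: "v \<in> V" and av: "a \<otimes> v \<notin> H"
    have c: "a \<in> carrier R" "v \<in> carrier R" using a v max_subset ideal.Icarr[OF V] by auto
    have avV: "a \<otimes> v \<in> V" using ideal.I_l_closed[OF V v c(1)] .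
    have iav: "ideal (PIdl (a \<otimes> v)) R" using c by (simp add: cgenideal_ideal)
    have iJ: "ideal (H <+> PIdl (a \<otimes> v)) R" using iH iav by (rule add_ideals)
    have sub: "H \<subseteq> H <+> PIdl (a \<otimes> v)" "a \<otimes> v \<in> H <+> PIdl (a \<otimes> v)"
      using set_add_upper1[OF iH iav] set_add_upper2[OF iH iav] cgenideal_self[of "a \<otimes> v"] c by auto
    have "H <+> PIdl (a \<otimes> v) \<notin> S"
      using max[OF _ sub(1)] sub(2) av by auto
    then have "H <+> PIdl (a \<otimes> v) = V"
      using iJ sub LH HV set_add_least[OF V _ PIdl_subset[OF V avV]] unfolding S_def by blast
    then obtain h b where h: "h \<in> H" "b \<in> PIdl (a \<otimes> v)" "v = h \<oplus> b"
      using v by (auto elim: set_addE)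
    then obtain r where r: "r \<in> carrier R" "b = r \<otimes> (a \<otimes> v)" by (auto elim: mem_PIdlE)
    have hc: "h \<in> carrier R" using ideal.Icarr[OF iH h(1)] .
    have ra: "r \<otimes> a \<in> \<mm>" using ideal.I_l_closed[OF ideal_max a r(1)] .
    have "\<one> \<ominus> r \<otimes> a \<notin> \<mm>"
    proof
      assume "\<one> \<ominus> r \<otimes> a \<in> \<mm>"
      then have "(\<one> \<ominus> r \<otimes> a) \<oplus> r \<otimes> a \<in> \<mm>" using ra ideal_add[OF ideal_max] by blast
      moreover have "(\<one> \<ominus> r \<otimes> a) \<oplus> r \<otimes> a = \<one>" using r c by algebra
      ultimately show False using one_notin_max by simp
    qed
    then have "\<one> \<ominus> r \<otimes> a \<in> Units R" using unit_iff_notin_max r c by simp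
    moreover have "(\<one> \<ominus> r \<otimes> a) \<otimes> v = v \<ominus> r \<otimes> (a \<otimes> v)" using r(1) c by algebra
    moreover have "(h \<oplus> r \<otimes> (a \<otimes> v)) \<ominus> r \<otimes> (a \<otimes> v) = h" using r(1) c hc by algebra
    then have "v \<ominus> r \<otimes> (a \<otimes> v) = h"
      unfolding h(3)[unfolded r(2), symmetric] .
    ultimately have "v \<in> H" using ideal_unit_cancel[OF iH] c h(1) by metis
    then show False using av ideal.I_l_closed[OF iH] c by blast
  qed
  have "V \<subseteq> H"
  proof
    fix v assume v: "v \<in> V"
    then obtain k w where kw: "k \<in> K" "w \<in> \<mm> \<cdot> V" "v = k \<oplus> w" using set_addE[of v K "\<mm> \<cdot> V"] le by blast
    have "k \<in> V"
      using ideal_diff_cancel[OF V ideal.Icarr[OF K kw(1)], of w] kw v mV(2) by auto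
    then have "k \<in> H" using kw LH unfolding L_def by auto
    then show "v \<in> H" using kw mVH ideal_add[OF iH] by auto
  qed
  then show False using HV by auto
qed

section \<open>Generators and length\<close>

text \<open>If \<open>\<mm>a \<subseteq> K\<close>, then \<open>K + Ra\<close> modulo \<open>K\<close> is a vector space over the residue field spanned by \<open>a\<close>:
  a multiple \<open>ra\<close> lies in \<open>K\<close> if \<open>r \<in> \<mm>\<close>, and otherwise generates \<open>a\<close>.\<close>

lemma quot_length_cyclic_le_1:
  assumes K: "ideal K R" and a: "a \<in> carrier R" and ma: "\<And>x. x \<in> \<mm> \<Longrightarrow> x \<otimes> a \<in> K"
  shows "quot_length K (K <+> PIdl a) \<le> 1"
proof (rule ccontr)
  assume "\<not> ?thesis"
  then have "eSuc 1 \<le> quot_length K (K <+> PIdl a)" by (simp add: ileI1)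
  then have "enat 2 \<le> quot_length K (K <+> PIdl a)"
    by (simp add: eSuc_enat one_enat_def numeral_2_eq_2)
  then obtain C where
    C: "\<forall>i\<le>2. ideal (C i) R \<and> K \<subseteq> C i \<and> C i \<subseteq> K <+> PIdl a" and "\<forall>i<2. C i \<subset> C (Suc i)"
    unfolding quot_length_ge_iff[OF K set_add_upper1[OF K cgenideal_ideal[OF a]]] by blast
  then have strict: "C 0 \<subset> C 1" "C 1 \<subset> C 2" by (auto simp: numeral_2_eq_2)
  have C1: "ideal (C 1) R" "K \<subseteq> C 1" and C0: "K \<subseteq> C 0" and C2: "C 2 \<subseteq> K <+> PIdl a" using C by auto
  obtain b where b: "b \<in> C 1" "b \<notin> C 0" using strict by blast
  then have "b \<in> K <+> PIdl a" using strict C2 by blast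
  then obtain k c where kc: "k \<in> K" "c \<in> PIdl a" "b = k \<oplus> c" by (rule set_addE)
  then obtain r where r: "r \<in> carrier R" "c = r \<otimes> a" by (auto elim: mem_PIdlE)
  show False
  proof (cases "r \<in> \<mm>")
    case True
    then show False using kc r ma ideal_add[OF K] b C0 by blast
  next
    case False
    then have "r \<in> Units R" using unit_iff_notin_max r by simp
    moreover have "r \<otimes> a \<in> C 1"
      using ideal_diff_cancel[OF C1(1), of "r \<otimes> a" k] kc b r a C1(2) ideal.Icarr[OF K kc(1)]
        a_comm[of k "r \<otimes> a"] by auto
    ultimately have "a \<in> C 1" using ideal_unit_cancel[OF C1(1)] a by blast
    then have "K <+> PIdl a \<subseteq> C 1" using set_add_least[OF C1] PIdl_subset[OF C1(1)] by blast
    then show False using strict C2 by blast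
  qed
qed

lemma quot_length_generated_le:
  assumes "finite A" "A \<subseteq> carrier R" and K: "ideal K R"
    and "\<And>a x. a \<in> A \<Longrightarrow> x \<in> \<mm> \<Longrightarrow> x \<otimes> a \<in> K"
  shows "quot_length K (K <+> Idl A) \<le> enat (card A)"
  using assms(1,2,4)
proof (induction A)
  case empty
  have "quot_length K K \<le> 0"
  proof (rule ccontr)
    assume "\<not> quot_length K K \<le> 0"
    then have "enat 1 \<le> quot_length K K" by (cases "quot_length K K") (auto simp: zero_enat_def)
    then obtain C where C: "\<forall>i\<le>1. ideal (C i) R \<and> K \<subseteq> C i \<and> C i \<subseteq> K" "\<forall>i<1. C i \<subset> C (Suc i)"
      unfolding quot_length_ge_iff[OF K order_refl] by blast
    then have "C 0 = K" "C (Suc 0) = K" "C 0 \<subset> C (Suc 0)" by auto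
    then show False by simp
  qed
  then show ?case by (simp add: Idl_empty set_add_zero[OF K] zero_enat_def[symmetric])
next
  case (insert a A)
  let ?J = "K <+> Idl A"
  have a: "a \<in> carrier R" "A \<subseteq> carrier R" using insert by auto
  then have i: "ideal (Idl A) R" "ideal (PIdl a) R" by (auto intro: genideal_ideal cgenideal_ideal)
  have J: "ideal ?J R" "K \<subseteq> ?J" using add_ideals[OF K i(1)] set_add_upper1[OF K i(1)] by auto
  have "quot_length K (K <+> Idl (insert a A)) = quot_length K ?J + quot_length ?J (?J <+> PIdl a)"
    unfolding set_add_Idl_insert[OF K a(2,1)]
    by (intro quot_length_add K J add_ideals i set_add_upper1)
  also have "\<dots> \<le> enat (card A) + 1"
    using insert J by (intro add_mono quot_length_cyclic_le_1) auto
  finally show ?case using insert by (simp add: one_enat_def)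
qed

lemma quot_length_max_prod_finite:
  assumes I: "ideal I R"
  shows "quot_length (\<mm> \<cdot> I) I < \<infinity>"
proof -
  obtain A where A: "A \<subseteq> carrier R" "finite A" "I = Idl A" using finetely_gen[OF I] by blast
  have mI: "ideal (\<mm> \<cdot> I) R" using ideal_max I by (rule ideal_prod_is_ideal)
  have "quot_length (\<mm> \<cdot> I) I \<le> quot_length (\<mm> \<cdot> I) (\<mm> \<cdot> I <+> Idl A)"
    using set_add_upper2[OF mI I] A(3) by (intro quot_length_mono) auto
  also have "\<dots> \<le> enat (card A)"
    using A genideal_self[OF A(1)]
    by (intro quot_length_generated_le mI) (auto intro: ideal_prod.prod)
  finally show ?thesis by (cases "quot_length (\<mm> \<cdot> I) I") auto
qed

text \<open>Each generator outside the ideal generated so far uses up at least one unit of length.\<close>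

lemma generators_modulo:
  assumes K: "ideal K R" and I: "ideal I R" and "K \<subseteq> I" "quot_length K I \<le> enat n"
  shows "\<exists>A\<subseteq>I. finite A \<and> card A \<le> n \<and> I = K <+> Idl A"
  using assms(1,3,4)
proof (induction n arbitrary: K)
  case 0
  then have "\<not> K \<subset> I"
    using quot_length_psubset[of K K I] I by (auto simp: zero_enat_def[symmetric])
  then have "K = I" using 0 by auto
  then show ?case by (intro exI[of _ "{}"]) (auto simp: Idl_empty set_add_zero[OF I])
next
  case (Suc n)
  note K = Suc.prems(1)
  show ?case
  proof (cases "K = I")
    case True
    then show ?thesis by (intro exI[of _ "{}"]) (auto simp: Idl_empty set_add_zero[OF I])
  next
    case False
    then obtain a where a: "a \<in> I" "a \<notin> K" using Suc.prems by blast
    have ac: "a \<in> carrier R" using ideal.Icarr[OF I a(1)] .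
    have ia: "ideal (PIdl a) R" using ac by (rule cgenideal_ideal)
    let ?J = "K <+> PIdl a"
    have J: "ideal ?J R" "K \<subseteq> ?J" "?J \<subseteq> I"
      using add_ideals[OF K ia] set_add_upper1[OF K ia] set_add_least[OF I] Suc.prems
        PIdl_subset[OF I a(1)] by auto
    have "a \<in> ?J" using set_add_upper2[OF K ia] cgenideal_self[OF ac] by auto
    then have "quot_length K K + 1 \<le> quot_length K ?J"
      using K J a by (intro quot_length_psubset) auto
    then have "1 \<le> quot_length K ?J" by (meson add_increasing order_trans zero_le order_refl)
    then have "1 + quot_length ?J I \<le> quot_length K I"
      using quot_length_add[OF K J(1) I J(2,3)] by (simp add: add_right_mono)
    also have "\<dots> \<le> enat (Suc n)" by fact
    finally have "quot_length ?J I \<le> enat n"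
      by (cases "quot_length ?J I") (auto simp: one_enat_def)
    then obtain A where A: "A \<subseteq> I" "finite A" "card A \<le> n" "I = ?J <+> Idl A"
      using Suc.IH[OF J(1,3)] by blast
    have Ac: "A \<subseteq> carrier R" using A(1) ideal_subset[OF I] by blast
    have iA: "ideal (Idl A) R" using Ac by (rule genideal_ideal)
    have "I \<subseteq> K <+> Idl (insert a A)"
      unfolding set_add_Idl_insert[OF K Ac ac]
    proof -
      have j: "ideal (K <+> Idl A) R" using K iA by (rule add_ideals)
      have j': "ideal ((K <+> Idl A) <+> PIdl a) R" using j ia by (rule add_ideals)
      show "I \<subseteq> (K <+> Idl A) <+> PIdl a"
        apply (subst A(4))
        using set_add_upper1[OF j ia] set_add_upper2[OF j ia] set_add_upper1[OF K iA]
          set_add_upper2[OF K iA] by (intro set_add_least j') auto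
    qed
    moreover have "K <+> Idl (insert a A) \<subseteq> I"
      using genideal_minimal[OF I] a A Suc.prems by (intro set_add_least I) auto
    moreover have "card (insert a A) \<le> Suc n" using A by (simp add: card_insert_if)
    ultimately show ?thesis using a A by (intro exI[of _ "insert a A"]) auto
  qed
qed

lemma min_generators_le:
  assumes I: "ideal I R"
  shows "enat (min_generators R I) \<le> quot_length (\<mm> \<cdot> I) I"
proof -
  have mI: "ideal (\<mm> \<cdot> I) R" "\<mm> \<cdot> I \<subseteq> I"
    using ideal_prod_is_ideal[OF ideal_max I] ideal_prod_inter[OF ideal_max I] by auto
  obtain n where n: "quot_length (\<mm> \<cdot> I) I = enat n"
    using quot_length_max_prod_finite[OF I] by auto
  then obtain A where A: "A \<subseteq> I" "finite A" "card A \<le> n" "I = \<mm> \<cdot> I <+> Idl A"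
    using generators_modulo[OF mI(1) I mI(2)] by (metis order_refl)
  have Ac: "A \<subseteq> carrier R" using A(1) ideal_subset[OF I] by blast
  have iA: "ideal (Idl A) R" using Ac by (rule genideal_ideal)
  have "I \<subseteq> Idl A <+> \<mm> \<cdot> I" using A(4) set_add_comm[OF ideal_subset ideal_subset, OF mI(1) iA] by simp
  then have "I = Idl A" using Nakayama[OF I iA] genideal_minimal[OF I A(1)] by blast
  then have "min_generators R I \<le> card A"
    unfolding min_generators_def using Ac A(2) by (intro Least_le) blast
  then show ?thesis using A(3) n by simp
qed

section \<open>Generic elements\<close>

text \<open>Multiplication by \<open>y\<close> is injective from \<open>V/N\<close> to \<open>R/P\<close>, so an element \<open>v\<close> with
  \<open>(sy + z)v \<in> P\<close> behaves like an eigenvector, for the eigenvalue \<open>s\<close>, of the partially defined operator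
  \<open>-y\<^sup>-\<^sup>1z\<close> on \<open>V/N\<close>. Eigenvectors for eigenvalues that are distinct in the residue field are
  independent, hence their number is at most the length of \<open>V/N\<close>.

  The ideal \<open>E\<close> in the proof is \<open>N\<close> together with the span of the eigenvectors for \<open>B\<close>. It is
  invariant under the operator (\<open>e'\<close> is the image of \<open>e\<close>) and contains no eigenvector for any
  eigenvalue incongruent to all those in \<open>B\<close>, so that the next eigenvector enlarges it.\<close>

lemma card_eigenvalues_le:
  assumes V: "ideal V R" and N: "ideal N R" and P: "ideal P R"
    and y: "y \<in> carrier R" and z: "z \<in> carrier R"
    and N_eq: "N = {v \<in> V. y \<otimes> v \<in> P}" and zN: "\<And>v. v \<in> N \<Longrightarrow> z \<otimes> v \<in> P"
    and B: "finite B" "B \<subseteq> carrier R" "pairwise (\<lambda>a b. a \<ominus> b \<notin> \<mm>) B"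
    and ev: "\<And>s. s \<in> B \<Longrightarrow> \<exists>v\<in>V - N. (s \<otimes> y \<oplus> z) \<otimes> v \<in> P"
  shows "enat (card B) \<le> quot_length N V"
proof -
  note Vc = ideal.Icarr[OF V]
  have NV: "N \<subseteq> V" using N_eq by auto
  have "\<exists>E. ideal E R \<and> N \<subseteq> E \<and> E \<subseteq> V \<and> enat (card B) \<le> quot_length N E \<and>
    (\<forall>e\<in>E. \<exists>e'\<in>E. z \<otimes> e \<oplus> y \<otimes> e' \<in> P) \<and>
    (\<forall>j\<in>carrier R. \<forall>v\<in>E. (\<forall>b\<in>B. j \<ominus> b \<notin> \<mm>) \<longrightarrow> (j \<otimes> y \<oplus> z) \<otimes> v \<in> P \<longrightarrow> v \<in> N)"
    using B ev
  proof (induction B)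
    case empty
    have "\<exists>e'\<in>N. z \<otimes> e \<oplus> y \<otimes> e' \<in> P" if "e \<in> N" for e
      using zN[OF that] that NV Vc ideal_zero[OF N] y z by (intro bexI[of _ \<zero>]) auto
    then show ?case using N NV by (intro exI[of _ N]) (auto simp: zero_enat_def[symmetric])
  next
    case (insert b B)
    have b: "b \<in> carrier R" using insert.prems by auto
    obtain E where E: "ideal E R" "N \<subseteq> E" "E \<subseteq> V" and card: "enat (card B) \<le> quot_length N E"
      and stable: "\<And>e. e \<in> E \<Longrightarrow> \<exists>e'\<in>E. z \<otimes> e \<oplus> y \<otimes> e' \<in> P"
      and no_ev: "\<And>j v. j \<in> carrier R \<Longrightarrow> v \<in> E \<Longrightarrow> (\<And>b. b \<in> B \<Longrightarrow> j \<ominus> b \<notin> \<mm>) \<Longrightarrow>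
        (j \<otimes> y \<oplus> z) \<otimes> v \<in> P \<Longrightarrow> v \<in> N"
      using insert.IH insert.prems by (auto simp: pairwise_insert)
    obtain v where v: "v \<in> V" "v \<notin> N" "(b \<otimes> y \<oplus> z) \<otimes> v \<in> P" using insert.prems(3)[of b] by auto
    have vE: "v \<notin> E"
      using no_ev[OF b, of v] v insert.prems(2) insert.hyps by (auto simp: pairwise_insert)
    have vc: "v \<in> carrier R" using Vc v by auto
    have iv: "ideal (PIdl v) R" using vc by (rule cgenideal_ideal)
    let ?E = "E <+> PIdl v"
    have E': "ideal ?E R" "E \<subseteq> ?E" "?E \<subseteq> V" "v \<in> ?E"
      using add_ideals[OF E(1) iv] set_add_upper1[OF E(1) iv] set_add_upper2[OF E(1) iv]
        set_add_least[OF V E(3) PIdl_subset[OF V v(1)]] cgenideal_self[OF vc] by auto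
    have "E \<subset> ?E" using vE E' by blast
    then have "quot_length N E + 1 \<le> quot_length N ?E"
      by (intro quot_length_psubset N E E')
    with card have "enat (card B) + 1 \<le> quot_length N ?E" by (meson add_right_mono order_trans)
    then have card': "enat (card (insert b B)) \<le> quot_length N ?E"
      using insert.hyps by (simp add: one_enat_def)
    have stable': "\<exists>e'\<in>?E. z \<otimes> w \<oplus> y \<otimes> e' \<in> P" if "w \<in> ?E" for w
    proof -
      obtain e c where e: "e \<in> E" "c \<in> carrier R" "w = e \<oplus> c \<otimes> v"
        using \<open>w \<in> ?E\<close> by (auto elim!: set_addE mem_PIdlE)
      obtain e' where e': "e' \<in> E" "z \<otimes> e \<oplus> y \<otimes> e' \<in> P" using stable[OF e(1)] by blast
      have cc: "e \<in> carrier R" "e' \<in> carrier R" using e e' E Vc by auto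
      have "(z \<otimes> e \<oplus> y \<otimes> e') \<oplus> c \<otimes> ((b \<otimes> y \<oplus> z) \<otimes> v) \<in> P"
        by (rule ideal_add[OF P e'(2) ideal.I_l_closed[OF P v(3) e(2)]])
      also have "(z \<otimes> e \<oplus> y \<otimes> e') \<oplus> c \<otimes> ((b \<otimes> y \<oplus> z) \<otimes> v) =
          z \<otimes> (e \<oplus> c \<otimes> v) \<oplus> y \<otimes> (e' \<oplus> c \<otimes> b \<otimes> v)"
        using cc e(2) vc b y z by algebra
      finally have "z \<otimes> w \<oplus> y \<otimes> (e' \<oplus> c \<otimes> b \<otimes> v) \<in> P" using e(3) by simp
      moreover have "e' \<oplus> c \<otimes> b \<otimes> v \<in> ?E"
        using e' e(2) b by (intro set_addI mem_PIdlI) auto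
      ultimately show ?thesis by blast
    qed
    have no_ev': "w \<in> N" if j: "j \<in> carrier R" and w: "w \<in> ?E"
      and jb: "\<And>b'. b' \<in> insert b B \<Longrightarrow> j \<ominus> b' \<notin> \<mm>" and jw: "(j \<otimes> y \<oplus> z) \<otimes> w \<in> P" for j w
    proof -
      obtain e c where e: "e \<in> E" "c \<in> carrier R" "w = e \<oplus> c \<otimes> v"
        using w by (auto elim!: set_addE mem_PIdlE)
      obtain e' where e': "e' \<in> E" "z \<otimes> e \<oplus> y \<otimes> e' \<in> P" using stable[OF e(1)] by blast
      have cc: "e \<in> carrier R" "e' \<in> carrier R" "w \<in> carrier R" "w \<in> V"
        using e e' E E' w Vc by auto
      \<comment> \<open>Applying \<open>b\<close> minus the operator to \<open>w\<close> kills the new eigenvector \<open>v\<close>, which leaves an element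
        of \<open>E\<close>, and multiplies the eigenvector \<open>w\<close> by \<open>b - j\<close>. The element \<open>u\<close> is the difference
        of the two results.\<close>
      define u where "u = (b \<ominus> j) \<otimes> w \<ominus> (b \<otimes> e \<ominus> e')"
      have "c \<otimes> ((b \<otimes> y \<oplus> z) \<otimes> v) \<oplus> (z \<otimes> e \<oplus> y \<otimes> e') \<ominus> (j \<otimes> y \<oplus> z) \<otimes> w \<in> P"
        by (rule ideal_diff[OF P ideal_add[OF P ideal.I_l_closed[OF P v(3) e(2)] e'(2)] jw])
      also have "c \<otimes> ((b \<otimes> y \<oplus> z) \<otimes> v) \<oplus> (z \<otimes> e \<oplus> y \<otimes> e') \<ominus> (j \<otimes> y \<oplus> z) \<otimes> w = y \<otimes> u"
        unfolding u_def e(3) using cc(1,2) e(2) vc b y z j by algebra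
      finally have "y \<otimes> u \<in> P" .
      have beE: "b \<otimes> e \<ominus> e' \<in> E"
        by (rule ideal_diff[OF E(1) ideal.I_l_closed[OF E(1) e(1) b] e'(1)])
      then have "u \<in> V" unfolding u_def
        using ideal_diff[OF V ideal.I_l_closed[OF V cc(4), of "b \<ominus> j"]] b j E(3) by auto
      then have "u \<in> E" using \<open>y \<otimes> u \<in> P\<close> N_eq E(2) by auto
      then have "u \<oplus> (b \<otimes> e \<ominus> e') \<in> E" using beE by (rule ideal_add[OF E(1)])
      also have "u \<oplus> (b \<otimes> e \<ominus> e') = (b \<ominus> j) \<otimes> w"
        unfolding u_def using cc b j by algebra
      finally have bjw: "(b \<ominus> j) \<otimes> w \<in> E" .
      have "b \<ominus> j \<notin> \<mm>"
      proof
        assume "b \<ominus> j \<in> \<mm>"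
        then have "\<zero> \<ominus> (b \<ominus> j) \<in> \<mm>" using ideal_diff[OF ideal_max ideal_zero[OF ideal_max]] by blast
        moreover have "\<zero> \<ominus> (b \<ominus> j) = j \<ominus> b" using b j by algebra
        ultimately show False using jb by auto
      qed
      then have "w \<in> E" using ideal_unit_cancel[OF E(1) _ cc(3) bjw] unit_iff_notin_max b j by simp
      then show ?thesis using no_ev j jb jw by auto
    qed
    show ?case
    proof (intro exI[of _ ?E] conjI ballI impI)
      fix j w assume "j \<in> carrier R" "w \<in> ?E" "\<forall>b'\<in>insert b B. j \<ominus> b' \<notin> \<mm>" "(j \<otimes> y \<oplus> z) \<otimes> w \<in> P"
      then show "w \<in> N" using no_ev' by blast
    qed (use E E' card' stable' in auto)
  qed
  then obtain E where "ideal E R" "N \<subseteq> E" "E \<subseteq> V" "enat (card B) \<le> quot_length N E" by blast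
  then show ?thesis using quot_length_mono[of E V N] by (meson order_trans)
qed

text \<open>For \<open>y \<in> \<mm>\<close> the image \<open>yV\<close> is contained in \<open>\<mm>V\<close>, so the condition says that modulo \<open>P\<close> it is as
  large as possible.\<close>

definition covers :: "'a set \<Rightarrow> 'a set \<Rightarrow> 'a \<Rightarrow> bool"
  where "covers P V y \<longleftrightarrow> \<mm> \<cdot> V \<subseteq> (y <# V) <+> P"

text \<open>Complements exist in the vector space \<open>V/\<mm>V\<close>: the ideal \<open>W\<close> is chosen maximal among those meeting
  \<open>K\<close> only in \<open>\<mm>V\<close>.\<close>

lemma exists_complement:
  assumes V: "ideal V R" and K: "ideal K R" and mVK: "\<mm> \<cdot> V \<subseteq> K"
  obtains W where "ideal W R" "W \<subseteq> V" "W \<inter> K = \<mm> \<cdot> V" "V \<subseteq> W <+> K"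
proof -
  have mV: "ideal (\<mm> \<cdot> V) R" "\<mm> \<cdot> V \<subseteq> V"
    using ideal_prod_is_ideal[OF ideal_max V] ideal_prod_inter[OF ideal_max V] by auto
  define S where "S = {W. ideal W R \<and> W \<subseteq> V \<and> W \<inter> K = \<mm> \<cdot> V}"
  have "\<mm> \<cdot> V \<in> S" using mV mVK unfolding S_def by auto
  then obtain W where "W \<in> S" and max: "\<And>J. J \<in> S \<Longrightarrow> W \<subseteq> J \<Longrightarrow> J = W"
    using ideal_maximal_element[of S] unfolding S_def by blast
  then have W: "ideal W R" "W \<subseteq> V" "W \<inter> K = \<mm> \<cdot> V" unfolding S_def by auto
  have "V \<subseteq> W <+> K"
  proof (rule subsetI, rule ccontr)
    fix v assume v: "v \<in> V" and nv: "v \<notin> W <+> K"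
    have vc: "v \<in> carrier R" using ideal.Icarr[OF V v] .
    have iv: "ideal (PIdl v) R" using vc by (rule cgenideal_ideal)
    have iWK: "ideal (W <+> K) R" using W K add_ideals by auto
    let ?J = "W <+> PIdl v"
    have J: "ideal ?J R" "W \<subseteq> ?J" "?J \<subseteq> V" "v \<in> ?J"
      using add_ideals[OF W(1) iv] set_add_upper1[OF W(1) iv] set_add_upper2[OF W(1) iv]
        set_add_least[OF V W(2) PIdl_subset[OF V v(1)]] cgenideal_self[OF vc] by auto
    have "?J \<inter> K \<subseteq> \<mm> \<cdot> V"
    proof
      fix k assume k: "k \<in> ?J \<inter> K"
      then obtain w r where wr: "w \<in> W" "r \<in> carrier R" "k = w \<oplus> r \<otimes> v"
        by (auto elim!: set_addE mem_PIdlE)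
      have c: "w \<in> carrier R" "k \<in> carrier R" using ideal.Icarr[OF W(1)] ideal.Icarr[OF K] wr(1) k by auto
      show "k \<in> \<mm> \<cdot> V"
      proof (cases "r \<in> \<mm>")
        case True
        then have "r \<otimes> v \<in> W" using ideal_prod.prod[OF True v, of R] W(3) by auto
        then have "k \<in> W" using wr ideal_add[OF W(1)] by auto
        then show ?thesis using k W(3) by auto
      next
        case False
        have "w \<oplus> r \<otimes> v \<ominus> w \<in> W <+> K"
          using k wr(1,3) set_add_upper1[OF W(1) K] set_add_upper2[OF W(1) K]
          by (intro ideal_diff[OF iWK]) auto
        moreover have "w \<oplus> r \<otimes> v \<ominus> w = r \<otimes> v" using c(1) wr(2) vc by algebra
        ultimately have "v \<in> W <+> K"
          using ideal_unit_cancel[OF iWK _ vc] False unit_iff_notin_max[OF wr(2)] by metis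
        then show ?thesis using nv by simp
      qed
    qed
    then have "?J \<in> S" using J W mVK unfolding S_def by auto
    then have "?J = W" using max J by auto
    then show False using J(4) nv set_add_upper1[OF W(1) K] by auto
  qed
  then show thesis using that W by blast
qed

text \<open>Covering is an open condition on the line of all \<open>sy + z\<close>, whose point at infinity is \<open>y\<close>. If
  \<open>W/\<mm>V\<close> is a complement in \<open>V/\<mm>V\<close> of the kernel of \<open>y\<close> modulo \<open>P\<close>, then \<open>y\<close> maps it bijectively onto
  the image of \<open>\<mm>V\<close> modulo \<open>P\<close>. If \<open>sy + z\<close> does not cover, then comparing lengths shows that it is
  not injective on \<open>W/\<mm>V\<close>, so that \<open>s\<close> is one of the finitely many eigenvalues counted by \<open>card_eigenvalues_le\<close>.\<close>

lemma finite_not_covers: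
  assumes V: "ideal V R" and P: "ideal P R" and mmV: "\<mm> \<cdot> (\<mm> \<cdot> V) \<subseteq> P"
    and fin: "quot_length P ((\<mm> \<cdot> V) <+> P) < \<infinity>"
    and y: "y \<in> \<mm>" and z: "z \<in> \<mm>" and cov: "covers P V y"
    and T: "T \<subseteq> carrier R" "pairwise (\<lambda>a b. a \<ominus> b \<notin> \<mm>) T"
  shows "finite {s \<in> T. \<not> covers P V (s \<otimes> y \<oplus> z)}"
proof -
  let ?N = "\<mm> \<cdot> V"
  have N: "ideal ?N R" "?N \<subseteq> V"
    using ideal_prod_is_ideal[OF ideal_max V] ideal_prod_inter[OF ideal_max V] by auto
  have iNP: "ideal (?N <+> P) R" using N P add_ideals by auto
  have c: "y \<in> carrier R" "z \<in> carrier R" using y z max_subset by auto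
  have kill: "u \<otimes> v \<in> P" if "u \<in> \<mm>" "v \<in> ?N" for u v
    using ideal_prod.prod[OF that, of R] mmV by auto
  let ?K = "{v \<in> V. y \<otimes> v \<in> P}"
  have K: "ideal ?K R" using V P c(1) by (rule ideal_scale_vimage)
  obtain W where W: "ideal W R" "W \<subseteq> V" "W \<inter> ?K = ?N" "V \<subseteq> W <+> ?K"
    using exists_complement[OF V K] kill[OF y] N(2) by blast
  have NW: "?N = {v \<in> W. y \<otimes> v \<in> P}" using W(2,3) by auto
  have iyW: "ideal (y <# W) R" using W c ideal_scale by auto
  have img: "(u <# W) <+> P \<subseteq> ?N <+> P" if "u \<in> \<mm>" for u
  proof -
    have "u <# W \<subseteq> ?N" using W(2) ideal_prod.prod[OF that, of _ V R] by (auto elim!: mem_scaleE)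
    then show ?thesis by (auto elim!: set_addE intro: set_addI)
  qed
  have yW: "(y <# W) <+> P = ?N <+> P"
  proof (rule antisym[OF img[OF y]])
    have iyWP: "ideal ((y <# W) <+> P) R" using iyW P by (rule add_ideals)
    have "y <# V \<subseteq> (y <# W) <+> P"
    proof
      fix a assume "a \<in> y <# V"
      then obtain v where v: "v \<in> V" "a = y \<otimes> v" by (auto elim: mem_scaleE)
      then obtain w k where wk: "w \<in> W" "k \<in> ?K" "v = w \<oplus> k" using set_addE[of v W ?K] W(4) by blast
      have "a = y \<otimes> w \<oplus> y \<otimes> k"
        unfolding v(2) wk(3) using c ideal.Icarr[OF W(1) wk(1)] ideal.Icarr[OF K wk(2)] by algebra
      then show "a \<in> (y <# W) <+> P" using wk by (auto intro!: set_addI mem_scaleI)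
    qed
    then have "(y <# V) <+> P \<subseteq> (y <# W) <+> P"
      using set_add_upper2[OF iyW P] by (intro set_add_least iyWP)
    then have "?N \<subseteq> (y <# W) <+> P" using cov unfolding covers_def by blast
    then show "?N <+> P \<subseteq> (y <# W) <+> P"
      using set_add_upper2[OF iyW P] by (intro set_add_least iyWP)
  qed
  have len: "quot_length ?N W = quot_length P (?N <+> P)"
    using quot_length_scale[OF W(1) P c(1)] yW NW by simp
  have ev: "\<exists>v\<in>W - ?N. (s \<otimes> y \<oplus> z) \<otimes> v \<in> P"
    if s: "s \<in> carrier R" and not: "\<not> covers P V (s \<otimes> y \<oplus> z)" for s
  proof (rule ccontr)
    let ?u = "s \<otimes> y \<oplus> z"
    assume none: "\<not> (\<exists>v\<in>W - ?N. ?u \<otimes> v \<in> P)"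
    have u: "?u \<in> \<mm>" using s y z by (intro ideal_add[OF ideal_max] ideal.I_l_closed[OF ideal_max])
    then have uc: "?u \<in> carrier R" using max_subset by blast
    have "{v \<in> W. ?u \<otimes> v \<in> P} = ?N"
      using none kill[OF u] NW by blast
    then have "quot_length P ((?u <# W) <+> P) = quot_length P (?N <+> P)"
      using quot_length_scale[OF W(1) P uc] len by simp
    moreover have iuW: "ideal (?u <# W) R" using W uc ideal_scale by auto
    ultimately have "(?u <# W) <+> P = ?N <+> P"
      using fin set_add_upper2[OF iuW P]
      by (intro quot_length_eqD[OF P add_ideals[OF iuW P] iNP _ img[OF u]]) auto
    then have "?N \<subseteq> (?u <# W) <+> P" using set_add_upper1[OF N(1) P] by simp
    also have "\<dots> \<subseteq> (?u <# V) <+> P"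
      using scale_mono[OF W(2)] by (auto elim!: set_addE intro: set_addI)
    finally show False using not unfolding covers_def by simp
  qed
  obtain n where n: "quot_length ?N W = enat n" using fin len by auto
  show ?thesis
  proof (rule ccontr)
    assume "infinite {s \<in> T. \<not> covers P V (s \<otimes> y \<oplus> z)}"
    then obtain B where B: "finite B" "card B = Suc n" "B \<subseteq> {s \<in> T. \<not> covers P V (s \<otimes> y \<oplus> z)}"
      using infinite_arbitrarily_large by blast
    have "enat (card B) \<le> quot_length ?N W"
      using B T ev kill[OF z]
      by (intro card_eigenvalues_le[OF W(1) N(1) P c NW]) (auto intro: pairwise_subset)
    then show False using B(2) n by simp
  qed
qed

lemma covers_unit_scale:
  assumes V: "ideal V R" and s: "s \<in> Units R" and y: "y \<in> carrier R" and cov: "covers P V y"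
  shows "covers P V (s \<otimes> y)"
proof -
  have "y <# V \<subseteq> (s \<otimes> y) <# V"
  proof
    fix a assume "a \<in> y <# V"
    then obtain v where v: "v \<in> V" "a = y \<otimes> v" by (auto elim: mem_scaleE)
    have "v \<in> carrier R" using ideal.Icarr[OF V v(1)] .
    then have "a = (inv s \<otimes> s) \<otimes> (y \<otimes> v)" using s y v by simp
    also have "\<dots> = (s \<otimes> y) \<otimes> (inv s \<otimes> v)"
      using \<open>v \<in> carrier R\<close> y Units_closed[OF s] Units_inv_closed[OF s] by algebra
    finally show "a \<in> (s \<otimes> y) <# V"
      using ideal.I_l_closed[OF V v(1) Units_inv_closed[OF s]] by (simp add: mem_scaleI)
  qed
  then show ?thesis using cov unfolding covers_def by (auto 4 4 elim!: set_addE intro: set_addI)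
qed

lemma exists_incongruent_units:
  assumes "infinite (carrier (R Quot \<mm>))"
  obtains T where "T \<subseteq> Units R" "infinite T" "pairwise (\<lambda>a b. a \<ominus> b \<notin> \<mm>) T"
proof -
  have "carrier (R Quot \<mm>) = (+>) \<mm> ` carrier R"
    by (auto simp: FactRing_def A_RCOSETS_defs a_r_coset_def)
  then obtain T where T: "T \<subseteq> carrier R" "inj_on ((+>) \<mm>) T" "carrier (R Quot \<mm>) = (+>) \<mm> ` T"
    by (metis subset_image_inj subset_refl)
  have inf: "infinite T" using assms T(3) by auto
  have pw: "pairwise (\<lambda>a b. a \<ominus> b \<notin> \<mm>) T"
    unfolding pairwise_def
    using T quotient_eq_iff_same_a_r_cos[OF ideal_max] by (metis inj_on_def subsetD)
  have "T \<inter> \<mm> \<subseteq> {t}" if "t \<in> T \<inter> \<mm>" for t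
    using that pw ideal_diff[OF ideal_max] unfolding pairwise_def by blast
  then have "finite (T \<inter> \<mm>)"
    by (metis ex_in_conv finite.emptyI finite_insert finite_subset)
  then have "infinite (T - \<mm>)" using inf by (metis Diff_Int2 Int_absorb finite_Diff2 finite_Un Int_Diff_Un)
  moreover have "T - \<mm> \<subseteq> Units R" using T(1) unit_iff_notin_max by auto
  moreover have "pairwise (\<lambda>a b. a \<ominus> b \<notin> \<mm>) (T - \<mm>)" using pw by (rule pairwise_subset) auto
  ultimately show thesis using that by blast
qed

text \<open>Two covering elements \<open>y\<close> and \<open>z\<close> for different ideals are combined into \<open>sz + y\<close>. For all but finitely
  many \<open>s\<close> this still covers where \<open>z\<close> does. It is \<open>s\<close> times \<open>s\<^sup>-\<^sup>1y + z\<close>, so for all but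
  finitely many units \<open>s\<close> it also covers where \<open>y\<close> does. An infinite residue field leaves room for a
  common choice.\<close>

lemma exists_common_cover:
  assumes inf: "infinite (carrier (R Quot \<mm>))" and P: "ideal P R" and "finite F"
    and "\<And>V. V \<in> F \<Longrightarrow> ideal V R" "\<And>V. V \<in> F \<Longrightarrow> \<mm> \<cdot> (\<mm> \<cdot> V) \<subseteq> P"
    and "\<And>V. V \<in> F \<Longrightarrow> quot_length P ((\<mm> \<cdot> V) <+> P) < \<infinity>"
    and "\<And>V. V \<in> F \<Longrightarrow> \<exists>y\<in>\<mm>. covers P V y"
  shows "\<exists>y\<in>\<mm>. \<forall>V\<in>F. covers P V y"
  using \<open>finite F\<close> assms(4-)
proof (induction F)
  case empty
  then show ?case using ideal_zero[OF ideal_max] by blast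
next
  case (insert V F)
  obtain y where y: "y \<in> \<mm>" "\<And>W. W \<in> F \<Longrightarrow> covers P W y" using insert by auto
  obtain z where z: "z \<in> \<mm>" "covers P V z" using insert.prems(4)[of V] by auto
  have c: "y \<in> carrier R" "z \<in> carrier R" using y z max_subset by auto
  obtain T where T: "T \<subseteq> Units R" "infinite T" "pairwise (\<lambda>a b. a \<ominus> b \<notin> \<mm>) T"
    using exists_incongruent_units[OF inf] .
  have Tc: "T \<subseteq> carrier R" using T(1) Units_closed by auto
  have bad1: "finite {s \<in> T. \<not> covers P V (s \<otimes> z \<oplus> y)}"
    using insert.prems y(1) z T(3) Tc by (intro finite_not_covers P) auto
  have bad2: "finite {s \<in> T. \<not> covers P W (inv s \<otimes> y \<oplus> z)}" if W: "W \<in> F" for W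
  proof -
    let ?T' = "(\<lambda>s. inv s) ` T"
    have "pairwise (\<lambda>a b. a \<ominus> b \<notin> \<mm>) ?T'"
    proof (clarsimp simp: pairwise_def)
      fix s t assume st: "s \<in> T" "t \<in> T" "inv s \<noteq> inv t" "inv s \<ominus> inv t \<in> \<mm>"
      have u: "s \<in> Units R" "t \<in> Units R" using st T by auto
      have "(s \<otimes> t) \<otimes> (inv s \<ominus> inv t) \<in> \<mm>"
        using ideal.I_l_closed[OF ideal_max st(4), of "s \<otimes> t"] u[THEN Units_closed] by simp
      also have "(s \<otimes> t) \<otimes> (inv s \<ominus> inv t) = t \<otimes> (s \<otimes> inv s) \<ominus> s \<otimes> (t \<otimes> inv t)"
        using u[THEN Units_closed] u[THEN Units_inv_closed] by algebra
      also have "\<dots> = t \<ominus> s" using u by (simp add: Units_closed)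
      finally have "t \<ominus> s \<in> \<mm>" .
      then show False using T(3) st unfolding pairwise_def by metis
    qed
    then have "finite {s \<in> ?T'. \<not> covers P W (s \<otimes> y \<oplus> z)}"
      using insert.prems W y z(1) T(1) by (intro finite_not_covers P) auto
    moreover have "inj_on (\<lambda>s. inv s) T"
      using T(1) by (metis Units_inv_inv inj_onI subsetD)
    ultimately have "finite ((\<lambda>s. inv s) -` {s \<in> ?T'. \<not> covers P W (s \<otimes> y \<oplus> z)} \<inter> T)"
      by (rule finite_vimage_IntI)
    then show ?thesis by (rule finite_subset[rotated]) auto
  qed
  define bad where "bad = {s \<in> T. \<not> covers P V (s \<otimes> z \<oplus> y)} \<union>
      (\<Union>W\<in>F. {s \<in> T. \<not> covers P W (inv s \<otimes> y \<oplus> z)})"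
  have "finite bad" unfolding bad_def using bad1 bad2 insert.hyps by auto
  then have "infinite (T - bad)" using T(2) by simp
  then obtain s where "s \<in> T - bad" by (metis ex_in_conv finite.emptyI)
  then have s: "s \<in> T" "covers P V (s \<otimes> z \<oplus> y)"
      "\<And>W. W \<in> F \<Longrightarrow> covers P W (inv s \<otimes> y \<oplus> z)"
    unfolding bad_def by auto
  have su: "s \<in> Units R" using s T by auto
  have "s \<otimes> (inv s \<otimes> y \<oplus> z) = (s \<otimes> inv s) \<otimes> y \<oplus> s \<otimes> z"
    using c Units_closed[OF su] Units_inv_closed[OF su] by algebra
  then have eq: "s \<otimes> (inv s \<otimes> y \<oplus> z) = s \<otimes> z \<oplus> y"
    using c su a_comm[of y "s \<otimes> z"] by (simp add: Units_closed)
  have "covers P W (s \<otimes> z \<oplus> y)" if "W \<in> F" for W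
    using covers_unit_scale[OF _ su _ s(3)[OF that]] insert.prems(1)[of W] that c su eq by auto
  moreover have "s \<otimes> z \<oplus> y \<in> \<mm>"
    using y z Units_closed[OF su] by (intro ideal_add[OF ideal_max] ideal.I_l_closed[OF ideal_max])
  ultimately show ?case using s(2) by blast
qed

section \<open>Powers of the maximal ideal\<close>

definition max_pow :: "nat \<Rightarrow> 'a set"
  where "max_pow n = \<mm> [^]\<^bsub>ideals_set R\<^esub> n"

lemma max_pow_0: "max_pow 0 = carrier R"
  by (simp add: max_pow_def nat_pow_def ideals_set_def)

lemma max_pow_Suc': "max_pow (Suc n) = max_pow n \<cdot> \<mm>"
  by (simp add: max_pow_def nat_pow_def ideals_set_def)

lemma ideal_max_pow: "ideal (max_pow n) R"
  by (induction n) (auto simp: max_pow_0 max_pow_Suc' oneideal ideal_prod_is_ideal ideal_max)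

lemma max_pow_Suc: "max_pow (Suc n) = \<mm> \<cdot> max_pow n"
  unfolding max_pow_Suc' by (rule ideal_prod_commute[OF ideal_max_pow ideal_max])

lemma max_pow_1: "max_pow (Suc 0) = \<mm>"
  unfolding max_pow_Suc max_pow_0 by (rule ideal_prod_one[OF ideal_max])

lemma max_pow_add: "max_pow (i + n) = max_pow i \<cdot> max_pow n"
proof (induction n)
  case 0
  then show ?case by (simp add: max_pow_0 ideal_prod_one ideal_max_pow)
next
  case (Suc n)
  then show ?case
    by (simp add: max_pow_Suc' ideal_prod_assoc ideal_max_pow ideal_max)
qed

lemma max_pow_antimono: "n \<le> i \<Longrightarrow> max_pow i \<subseteq> max_pow n"
proof (induction i rule: dec_induct)
  case (step i)
  have "max_pow (Suc i) \<subseteq> max_pow i"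
    using ideal_prod_inter[OF ideal_max ideal_max_pow] by (auto simp: max_pow_Suc)
  then show ?case using step by blast
qed auto

lemma pow_mem_max_pow: "x \<in> \<mm> \<Longrightarrow> x [^] (n::nat) \<in> max_pow n"
  by (induction n) (auto simp: max_pow_0 max_pow_Suc' intro: ideal_prod.prod)

lemma scale_max_pow_subset:
  assumes "w \<in> max_pow i"
  shows "w <# max_pow n \<subseteq> max_pow (i + n)"
  unfolding max_pow_add using assms by (auto elim!: mem_scaleE intro: ideal_prod.prod)

lemma quot_length_max_pow_finite: "quot_length (max_pow n) (carrier R) < \<infinity>"
proof (induction n)
  case 0
  have "quot_length (\<mm> \<cdot> carrier R) (carrier R) < \<infinity>"
    by (rule quot_length_max_prod_finite[OF oneideal])
  then show ?case
    unfolding max_pow_0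
    by (rule order_le_less_trans[OF quot_length_antimono[OF ideal_prod_in_carrier[OF ideal_max oneideal]]])
next
  case (Suc n)
  have "quot_length (max_pow (Suc n)) (carrier R) =
      quot_length (max_pow (Suc n)) (max_pow n) + quot_length (max_pow n) (carrier R)"
    using max_pow_antimono[of n "Suc n"]
    by (intro quot_length_add ideal_max_pow oneideal ideal_subset) auto
  moreover have "quot_length (max_pow (Suc n)) (max_pow n) < \<infinity>"
    unfolding max_pow_Suc by (rule quot_length_max_prod_finite[OF ideal_max_pow])
  ultimately show ?case using Suc by auto
qed

section \<open>Principal reductions of the maximal ideal\<close>

text \<open>The case of principal reductions of the theorem of Eakin and Sathaye, in a form suited to induction.
  Everything takes place in the vector space \<open>\<mm>\<^sup>N/\<mm>\<^sup>N\<^sup>+\<^sup>1\<close>.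

  For \<open>n = 0\<close> the space in question is at most a line, hence spanned by any nonzero \<open>wy\<close> in it. For larger
  \<open>n\<close> the claim is immediate if \<open>xw\<mm>\<^sup>n\<close> already fills \<open>w\<mm>\<^sup>n\<^sup>+\<^sup>1\<close> for some \<open>x \<in> \<mm>\<close>. If not,
  passing from \<open>w\<close> to \<open>xw\<close> lowers the dimension as well as \<open>n\<close>, so the induction hypothesis gives
  for every \<open>x \<in> \<mm>\<close> an element that covers \<open>xw\<mm>\<^sup>n\<^sup>-\<^sup>1\<close>. A common choice \<open>y\<close> for the finitely many
  generators \<open>x\<close> of \<open>\<mm>\<close> works for \<open>w\<close>, because \<open>w\<mm>\<^sup>n\<^sup>+\<^sup>1\<close> is the sum of the ideals
  \<open>xw\<mm>\<^sup>n\<close>.\<close>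

lemma exists_linear_cover:
  assumes inf: "infinite (carrier (R Quot \<mm>))" and P: "P = max_pow (Suc N)"
    and "w \<in> max_pow i" "i + Suc n = N"
    and "quot_length P ((w <# max_pow (Suc n)) <+> P) \<le> enat (Suc n)"
  shows "\<exists>y\<in>\<mm>. w <# max_pow (Suc n) \<subseteq> ((y \<otimes> w) <# max_pow n) <+> P"
  using assms(3-)
proof (induction n arbitrary: w i)
  case 0
  have iP: "ideal P R" unfolding P by (rule ideal_max_pow)
  have w: "w \<in> carrier R" using 0 ideal.Icarr[OF ideal_max_pow] by blast
  let ?Y = "(w <# \<mm>) <+> P"
  have iw: "ideal (w <# \<mm>) R" using w ideal_max ideal_scale by auto
  have iY: "ideal ?Y R" using iw iP by (rule add_ideals)
  show ?case
  proof (cases "w <# \<mm> \<subseteq> P")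
    case True
    have "ideal ((\<zero> \<otimes> w) <# carrier R) R" using w ideal_scale[OF oneideal] by auto
    then have "P \<subseteq> ((\<zero> \<otimes> w) <# carrier R) <+> P" using iP by (rule set_add_upper2)
    then show ?thesis
      using True ideal_zero[OF ideal_max] unfolding max_pow_1 max_pow_0 by blast
  next
    case False
    then obtain y where y: "y \<in> \<mm>" "w \<otimes> y \<notin> P" by (auto elim!: mem_scaleE)
    have yc: "y \<in> carrier R" using y max_subset by auto
    let ?Z = "((y \<otimes> w) <# carrier R) <+> P"
    have iyw: "ideal ((y \<otimes> w) <# carrier R) R" using w yc ideal_scale[OF oneideal] by auto
    have iZ: "ideal ?Z R" using iyw iP by (rule add_ideals)
    have "y \<otimes> w \<otimes> \<one> \<in> ?Z" using set_add_upper1[OF iyw iP] mem_scaleI[of \<one> "carrier R"] by auto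
    then have "P \<subset> ?Z" using y w yc set_add_upper2[OF iyw iP] by (auto simp: m_comm)
    then have "quot_length P P + 1 \<le> quot_length P ?Z" by (intro quot_length_psubset iP iZ) auto
    then have 1: "1 \<le> quot_length P ?Z" by (meson add_increasing order_trans zero_le order_refl)
    have "?Z \<subseteq> ?Y"
    proof (rule set_add_least[OF iY _ set_add_upper2[OF iw iP]])
      have "y \<otimes> w \<otimes> r \<in> w <# \<mm>" if "r \<in> carrier R" for r
      proof -
        have "y \<otimes> w \<otimes> r = w \<otimes> (y \<otimes> r)" using w yc that by algebra
        then show ?thesis using mem_scaleI ideal.I_r_closed[OF ideal_max y(1) that] by metis
      qed
      then show "(y \<otimes> w) <# carrier R \<subseteq> ?Y"
        using set_add_upper1[OF iw iP] by (auto elim!: mem_scaleE)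
    qed
    moreover have "\<not> ?Z \<subset> ?Y"
    proof
      assume "?Z \<subset> ?Y"
      then have "quot_length P ?Z + 1 \<le> quot_length P ?Y"
        using \<open>P \<subset> ?Z\<close> by (intro quot_length_psubset iP iZ iY) auto
      also have "\<dots> \<le> 1" using 0 by (simp add: max_pow_1 one_enat_def)
      finally show False using 1 by (cases "quot_length P ?Z") (auto simp: one_enat_def)
    qed
    ultimately have "w <# \<mm> \<subseteq> ?Z" using set_add_upper1[OF iw iP] by auto
    then show ?thesis using y unfolding max_pow_1 max_pow_0 by blast
  qed
next
  case (Suc n)
  have iP: "ideal P R" unfolding P by (rule ideal_max_pow)
  have w: "w \<in> carrier R" using Suc ideal.Icarr[OF ideal_max_pow] by blast
  let ?Y = "(w <# max_pow (Suc (Suc n))) <+> P"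
  have iw: "ideal (w <# max_pow k) R" for k using w ideal_max_pow ideal_scale by auto
  have iY: "ideal ?Y R" using iw iP by (rule add_ideals)
  let ?Z = "\<lambda>x. ((x \<otimes> w) <# max_pow (Suc n)) <+> P"
  have ixw: "ideal ((x \<otimes> w) <# max_pow k) R" if "x \<in> carrier R" for x k
    using w that ideal_max_pow ideal_scale by auto
  have iZ: "ideal (?Z x) R" if "x \<in> carrier R" for x using ixw[OF that] iP by (rule add_ideals)
  have ZY: "?Z x \<subseteq> ?Y" if x: "x \<in> \<mm>" for x
  proof (rule set_add_least[OF iY _ set_add_upper2[OF iw iP]])
    have "(x \<otimes> w) \<otimes> c \<in> w <# max_pow (Suc (Suc n))" if "c \<in> max_pow (Suc n)" for c
    proof -
      have "(x \<otimes> w) \<otimes> c = w \<otimes> (x \<otimes> c)"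
        using w max_subset x ideal.Icarr[OF ideal_max_pow that] by (simp add: m_comm m_lcomm m_assoc subsetD)
      moreover have "x \<otimes> c \<in> max_pow (Suc (Suc n))"
        unfolding max_pow_Suc[of "Suc n"] using x that by (rule ideal_prod.prod)
      ultimately show ?thesis using mem_scaleI by metis
    qed
    then show "(x \<otimes> w) <# max_pow (Suc n) \<subseteq> ?Y"
      using set_add_upper1[OF iw iP] by (auto elim!: mem_scaleE)
  qed
  show ?case
  proof (cases "\<exists>x\<in>\<mm>. ?Z x = ?Y")
    case True
    then show ?thesis using set_add_upper1[OF iw iP] by metis
  next
    case False
    let ?V = "\<lambda>x. (x \<otimes> w) <# max_pow n"
    obtain A where A: "A \<subseteq> carrier R" "finite A" "\<mm> = Idl A" using finetely_gen[OF ideal_max] by blast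
    have Am: "A \<subseteq> \<mm>" using A genideal_self by auto
    have mV: "\<mm> \<cdot> ?V x = (x \<otimes> w) <# max_pow (Suc n)" if "x \<in> \<mm>" for x
      unfolding max_pow_Suc using scale_prod[OF ideal_max ideal_max_pow] that w max_subset by auto
    have xw: "x \<otimes> w \<in> max_pow (Suc i)" if "x \<in> \<mm>" for x
      unfolding max_pow_Suc using that Suc.prems by (intro ideal_prod.prod)
    have cov: "\<exists>y\<in>\<mm>. covers P (?V x) y" if x: "x \<in> \<mm>" for x
    proof -
      have xc: "x \<in> carrier R" using x max_subset by auto
      have "?Z x \<subset> ?Y" using False ZY x by blast
      then have "quot_length P (?Z x) + 1 \<le> quot_length P ?Y"
        by (intro quot_length_psubset iP iZ iY xc set_add_upper2[OF ixw[OF xc] iP])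
      also have "\<dots> \<le> enat (Suc (Suc n))" by (rule Suc.prems)
      finally have "quot_length P (?Z x) \<le> enat (Suc n)"
        by (cases "quot_length P (?Z x)") (auto simp: one_enat_def)
      then obtain y where y: "y \<in> \<mm>"
          "(x \<otimes> w) <# max_pow (Suc n) \<subseteq> ((y \<otimes> (x \<otimes> w)) <# max_pow n) <+> P"
        using Suc.IH[OF xw[OF x]] Suc.prems by auto
      have "(y \<otimes> (x \<otimes> w)) <# max_pow n = y <# ?V x"
        using y(1) max_subset xc w by (intro scale_scale[symmetric] ideal_subset ideal_max_pow) auto
      then show ?thesis using y mV[OF x] unfolding covers_def by auto
    qed
    have VN: "?V x \<subseteq> max_pow (i + Suc n)" if "x \<in> \<mm>" for x
      using scale_max_pow_subset[OF xw[OF that], of n] by simp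
    have VN': "\<mm> \<cdot> ?V x \<subseteq> max_pow N" if "x \<in> \<mm>" for x
      using ideal_prod_mono[OF order_refl VN[OF that], of \<mm>] Suc.prems(2) max_pow_Suc[of "i + Suc n"]
      by auto
    have "\<exists>y\<in>\<mm>. \<forall>V\<in>?V ` A. covers P V y"
    proof (rule exists_common_cover[OF inf iP])
      fix V assume "V \<in> ?V ` A"
      then obtain x where x: "x \<in> \<mm>" "x \<in> carrier R" "V = ?V x" using Am max_subset by auto
      show "ideal V R" using x ixw by auto
      show "\<exists>y\<in>\<mm>. covers P V y" using x cov by auto
      show "\<mm> \<cdot> (\<mm> \<cdot> V) \<subseteq> P"
        using ideal_prod_mono[OF order_refl VN'[OF x(1)], of \<mm>] unfolding P max_pow_Suc x(3) .
      have "(\<mm> \<cdot> V) <+> P \<subseteq> carrier R"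
        using VN'[OF x(1)] x(3) ideal_subset[OF ideal_max_pow] ideal_subset[OF iP]
        by (intro set_add_least[OF oneideal]) auto
      then show "quot_length P ((\<mm> \<cdot> V) <+> P) < \<infinity>"
        unfolding P by (rule order_le_less_trans[OF quot_length_mono quot_length_max_pow_finite])
    qed (use A in auto)
    then obtain y where y: "y \<in> \<mm>" "\<And>x. x \<in> A \<Longrightarrow> covers P (?V x) y" by auto
    have yc: "y \<in> carrier R" using y max_subset by auto
    let ?G = "((y \<otimes> w) <# max_pow (Suc n)) <+> P"
    note iG = iZ[OF yc]
    have gen: "w \<otimes> (x \<otimes> c) \<in> ?G" if x: "x \<in> A" and c: "c \<in> max_pow (Suc n)" for x c
    proof -
      have cc: "x \<in> carrier R" "x \<in> \<mm>" "c \<in> carrier R"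
        using x A Am ideal.Icarr[OF ideal_max_pow c] by auto
      have "w \<otimes> (x \<otimes> c) = (x \<otimes> w) \<otimes> c" using w cc by algebra
      then have "w \<otimes> (x \<otimes> c) \<in> \<mm> \<cdot> ?V x" unfolding mV[OF cc(2)] using mem_scaleI[OF c] by metis
      also have "\<dots> \<subseteq> (y <# ?V x) <+> P" using y(2)[OF x] unfolding covers_def .
      also have "y <# ?V x \<subseteq> (y \<otimes> w) <# max_pow (Suc n)"
      proof
        fix a assume "a \<in> y <# ?V x"
        then obtain d where d: "d \<in> max_pow n" "a = y \<otimes> ((x \<otimes> w) \<otimes> d)" by (auto elim!: mem_scaleE)
        have "a = (y \<otimes> w) \<otimes> (x \<otimes> d)"
          unfolding d(2) using yc w cc ideal.Icarr[OF ideal_max_pow d(1)] by algebra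
        moreover have "x \<otimes> d \<in> max_pow (Suc n)"
          unfolding max_pow_Suc using cc d by (intro ideal_prod.prod)
        ultimately show "a \<in> (y \<otimes> w) <# max_pow (Suc n)" using mem_scaleI by metis
      qed
      then have "(y <# ?V x) <+> P \<subseteq> ?G" by (auto elim!: set_addE intro: set_addI)
      finally show ?thesis .
    qed
    define H where "H = {x \<in> \<mm>. \<forall>c\<in>max_pow (Suc n). w \<otimes> (x \<otimes> c) \<in> ?G}"
    have "ideal H R"
    proof (rule ideal_by_closure)
      note cl = subsetD[OF max_subset] ideal.Icarr[OF ideal_max_pow]
      show "H \<subseteq> carrier R" using max_subset unfolding H_def by auto
      show "\<zero> \<in> H" using w cl ideal_zero[OF ideal_max] ideal_zero[OF iG] unfolding H_def by auto
      show "a \<oplus> b \<in> H" if "a \<in> H" "b \<in> H" for a b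
        using that w cl ideal_add[OF ideal_max] ideal_add[OF iG]
        unfolding H_def by (auto simp: l_distr r_distr)
      show "r \<otimes> a \<in> H" if r: "r \<in> carrier R" and a: "a \<in> H" for r a
      proof -
        have "w \<otimes> (r \<otimes> a \<otimes> c) \<in> ?G" if c: "c \<in> max_pow (Suc n)" for c
        proof -
          have "w \<otimes> (r \<otimes> a \<otimes> c) = r \<otimes> (w \<otimes> (a \<otimes> c))"
            using w r a cl(1)[of a] cl(2)[OF c] unfolding H_def by (simp add: m_assoc m_lcomm)
          also have "\<dots> \<in> ?G" using a c r unfolding H_def by (auto intro: ideal.I_l_closed[OF iG])
          finally show ?thesis .
        qed
        then show ?thesis using a r ideal.I_l_closed[OF ideal_max] unfolding H_def by auto
      qed
    qed
    moreover have "A \<subseteq> H" using gen Am unfolding H_def by auto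
    ultimately have "\<mm> \<subseteq> H" using A(3) genideal_minimal by auto
    have "w \<otimes> c \<in> ?G" if "c \<in> \<mm> \<cdot> max_pow (Suc n)" for c
      using that
    proof induction
      case (prod x c)
      then show ?case using \<open>\<mm> \<subseteq> H\<close> unfolding H_def by blast
    next
      case (sum s t)
      then have "s \<in> carrier R" "t \<in> carrier R"
        using ideal_prod_in_carrier[OF ideal_max ideal_max_pow] by auto
      then show ?case using sum w ideal_add[OF iG] by (simp add: r_distr)
    qed
    then have "w <# max_pow (Suc (Suc n)) \<subseteq> ?G"
      unfolding max_pow_Suc[of "Suc n"] by (auto elim!: mem_scaleE)
    then show ?thesis using y(1) by blast
  qed
qed

text \<open>The case \<open>w = 1\<close> of \<open>exists_linear_cover\<close>, combined with Nakayama's lemma.\<close>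

lemma exists_principal_reduction:
  assumes inf: "infinite (carrier (R Quot \<mm>))"
    and "quot_length (max_pow (Suc (Suc n))) (max_pow (Suc n)) \<le> enat (Suc n)"
  shows "\<exists>y\<in>\<mm>. max_pow (Suc n) = y <# max_pow n"
proof -
  let ?P = "max_pow (Suc (Suc n))"
  have sub: "?P \<subseteq> max_pow (Suc n)" by (rule max_pow_antimono) simp
  have one: "\<one> <# max_pow k = max_pow k" for k by (rule scale_one[OF ideal_subset[OF ideal_max_pow]])
  have "max_pow (Suc n) <+> ?P = max_pow (Suc n)"
    using set_add_least[OF ideal_max_pow order_refl sub] set_add_upper1[OF ideal_max_pow ideal_max_pow]
    by (rule antisym)
  then obtain y where y: "y \<in> \<mm>" "max_pow (Suc n) \<subseteq> (y <# max_pow n) <+> ?P"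
    using exists_linear_cover[OF inf refl, of \<one> 0 n "Suc n"] assms(2) one max_subset
    by (auto simp: max_pow_0 subset_iff)
  have yc: "y \<in> carrier R" using y max_subset by auto
  have "max_pow (Suc n) \<subseteq> y <# max_pow n"
    using Nakayama[OF ideal_max_pow ideal_scale[OF ideal_max_pow yc]] y(2)
    unfolding max_pow_Suc[of "Suc n"] .
  moreover have "y <# max_pow n \<subseteq> max_pow (Suc n)"
    using scale_max_pow_subset[of y 1 n] y(1) max_pow_1 by simp
  ultimately show ?thesis using y(1) by blast
qed

section \<open>Ideals containing a power of the maximal ideal\<close>

text \<open>An ideal \<open>M\<close> maximal among those containing \<open>J\<close> but no power of \<open>\<mm>\<close> is prime: if \<open>a\<close> and \<open>b\<close> are not
  in \<open>M\<close>, then \<open>M + Ra\<close> and \<open>M + Rb\<close> contain powers of \<open>\<mm>\<close>, hence so does their product, which lies in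
  \<open>M + Rab\<close>.\<close>

lemma exists_prime_if_no_max_pow_subset:
  assumes J: "ideal J R" and none: "\<nexists>t. max_pow t \<subseteq> J"
  obtains p where "primeideal p R" "J \<subseteq> p" "p \<noteq> \<mm>"
proof -
  define S where "S = {K. ideal K R \<and> J \<subseteq> K \<and> (\<nexists>t. max_pow t \<subseteq> K)}"
  have "J \<in> S" using J none unfolding S_def by auto
  then obtain M where "M \<in> S" and max: "\<And>K. K \<in> S \<Longrightarrow> M \<subseteq> K \<Longrightarrow> K = M"
    using ideal_maximal_element[of S] unfolding S_def by blast
  then have M: "ideal M R" "J \<subseteq> M" and noneM: "\<And>t. \<not> max_pow t \<subseteq> M" unfolding S_def by auto
  have above: "\<exists>t. max_pow t \<subseteq> M <+> PIdl a" if a: "a \<in> carrier R" "a \<notin> M" for a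
  proof (rule ccontr)
    assume none: "\<nexists>t. max_pow t \<subseteq> M <+> PIdl a"
    have ia: "ideal (PIdl a) R" using a(1) by (rule cgenideal_ideal)
    note MJ = add_ideals[OF M(1) ia] set_add_upper1[OF M(1) ia]
    have "a \<in> M <+> PIdl a" using set_add_upper2[OF M(1) ia] cgenideal_self[OF a(1)] by auto
    moreover have "M <+> PIdl a \<in> S" using MJ M(2) none unfolding S_def by auto
    ultimately show False using max MJ(2) a(2) by auto
  qed
  have "primeideal M R"
  proof (rule primeidealI[OF M(1) cring_axioms])
    show "carrier R \<noteq> M" using noneM[of 0] max_pow_0 by auto
    fix a b assume ab: "a \<in> carrier R" "b \<in> carrier R" "a \<otimes> b \<in> M"
    show "a \<in> M \<or> b \<in> M"
    proof (rule ccontr)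
      assume "\<not> (a \<in> M \<or> b \<in> M)"
      then obtain s t where s: "max_pow s \<subseteq> M <+> PIdl a" and t: "max_pow t \<subseteq> M <+> PIdl b"
        using above[of a] above[of b] ab by blast
      have "(M <+> PIdl a) \<cdot> (M <+> PIdl b) \<subseteq> M"
      proof (rule ideal_prod_least[OF M(1)])
        fix c d assume "c \<in> M <+> PIdl a" "d \<in> M <+> PIdl b"
        then obtain k r l q where c: "k \<in> M" "r \<in> carrier R" "c = k \<oplus> r \<otimes> a"
          and d: "l \<in> M" "q \<in> carrier R" "d = l \<oplus> q \<otimes> b"
          by (auto elim!: set_addE mem_PIdlE)
        have kl: "k \<in> carrier R" "l \<in> carrier R" using c d ideal.Icarr[OF M(1)] by auto
        have "(l \<oplus> q \<otimes> b) \<otimes> k \<oplus> (r \<otimes> a) \<otimes> l \<oplus> (r \<otimes> q) \<otimes> (a \<otimes> b) \<in> M"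
          by (intro ideal_add[OF M(1)] ideal.I_l_closed[OF M(1) c(1)] ideal.I_l_closed[OF M(1) d(1)]
              ideal.I_l_closed[OF M(1) ab(3)] m_closed a_closed c(2) d(2) ab kl)
        also have "(l \<oplus> q \<otimes> b) \<otimes> k \<oplus> (r \<otimes> a) \<otimes> l \<oplus> (r \<otimes> q) \<otimes> (a \<otimes> b) = (k \<oplus> r \<otimes> a) \<otimes> (l \<oplus> q \<otimes> b)"
          using c(2) d(2) ab kl by algebra
        finally show "c \<otimes> d \<in> M" using c(3) d(3) by simp
      qed
      then have "max_pow (s + t) \<subseteq> M"
        unfolding max_pow_add using ideal_prod_mono[OF s t] by blast
      then show False using noneM by blast
    qed
  qed
  moreover have "M \<noteq> \<mm>" using noneM[of "Suc 0"] max_pow_1 by auto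
  ultimately show thesis using that M(2) by blast
qed

text \<open>Krull's theorem: an ideal maximal among those disjoint from a multiplicative set is prime.\<close>

lemma exists_prime_disjoint:
  assumes S: "S \<subseteq> carrier R" "\<one> \<in> S" "\<zero> \<notin> S" and mult: "\<And>a b. a \<in> S \<Longrightarrow> b \<in> S \<Longrightarrow> a \<otimes> b \<in> S"
  obtains q where "primeideal q R" "q \<inter> S = {}"
proof -
  define Q where "Q = {K. ideal K R \<and> K \<inter> S = {}}"
  have "{\<zero>} \<in> Q" using zeroideal S unfolding Q_def by auto
  then obtain M where "M \<in> Q" and max: "\<And>K. K \<in> Q \<Longrightarrow> M \<subseteq> K \<Longrightarrow> K = M"
    using ideal_maximal_element[of Q] unfolding Q_def by blast
  then have M: "ideal M R" "M \<inter> S = {}" unfolding Q_def by auto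
  have above: "\<exists>k r. k \<in> M \<and> r \<in> carrier R \<and> k \<oplus> r \<otimes> a \<in> S" if a: "a \<in> carrier R" "a \<notin> M" for a
  proof -
    have ia: "ideal (PIdl a) R" using a(1) by (rule cgenideal_ideal)
    note MJ = add_ideals[OF M(1) ia] set_add_upper1[OF M(1) ia]
    have "a \<in> M <+> PIdl a" using set_add_upper2[OF M(1) ia] cgenideal_self[OF a(1)] by auto
    then have "M <+> PIdl a \<notin> Q" using max MJ(2) a(2) by auto
    then have "(M <+> PIdl a) \<inter> S \<noteq> {}" using MJ unfolding Q_def by auto
    then show ?thesis by (auto elim!: set_addE mem_PIdlE)
  qed
  have "primeideal M R"
  proof (rule primeidealI[OF M(1) cring_axioms])
    show "carrier R \<noteq> M" using M S by auto
    fix a b assume ab: "a \<in> carrier R" "b \<in> carrier R" "a \<otimes> b \<in> M"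
    show "a \<in> M \<or> b \<in> M"
    proof (rule ccontr)
      assume "\<not> (a \<in> M \<or> b \<in> M)"
      then obtain k r l q where c: "k \<in> M" "r \<in> carrier R" "k \<oplus> r \<otimes> a \<in> S"
          and d: "l \<in> M" "q \<in> carrier R" "l \<oplus> q \<otimes> b \<in> S"
        using above[of a] above[of b] ab by blast
      have kl: "k \<in> carrier R" "l \<in> carrier R" using c d ideal.Icarr[OF M(1)] by auto
      have "(l \<oplus> q \<otimes> b) \<otimes> k \<oplus> (r \<otimes> a) \<otimes> l \<oplus> (r \<otimes> q) \<otimes> (a \<otimes> b) \<in> M"
        by (intro ideal_add[OF M(1)] ideal.I_l_closed[OF M(1) c(1)] ideal.I_l_closed[OF M(1) d(1)]
              ideal.I_l_closed[OF M(1) ab(3)] m_closed a_closed c(2) d(2) ab kl)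
      also have "(l \<oplus> q \<otimes> b) \<otimes> k \<oplus> (r \<otimes> a) \<otimes> l \<oplus> (r \<otimes> q) \<otimes> (a \<otimes> b) = (k \<oplus> r \<otimes> a) \<otimes> (l \<oplus> q \<otimes> b)"
        using c(2) d(2) ab kl by algebra
      finally show False using mult[OF c(3) d(3)] M(2) by auto
    qed
  qed
  then show thesis using that M(2) by blast
qed

definition nonzerodivisor :: "'a \<Rightarrow> bool"
  where "nonzerodivisor x \<longleftrightarrow> x \<in> carrier R \<and> (\<forall>a\<in>carrier R. x \<otimes> a = \<zero> \<longrightarrow> a = \<zero>)"

lemma nonzerodivisor_closed: "nonzerodivisor x \<Longrightarrow> x \<in> carrier R"
  unfolding nonzerodivisor_def by blast

lemma nonzerodivisorD:
  "nonzerodivisor x \<Longrightarrow> a \<in> carrier R \<Longrightarrow> x \<otimes> a = \<zero> \<Longrightarrow> a = \<zero>"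
  unfolding nonzerodivisor_def by blast

lemma nonzerodivisorI:
  "x \<in> carrier R \<Longrightarrow> (\<And>a. a \<in> carrier R \<Longrightarrow> x \<otimes> a = \<zero> \<Longrightarrow> a = \<zero>) \<Longrightarrow> nonzerodivisor x"
  unfolding nonzerodivisor_def by blast

lemma nonzerodivisor_pow: "nonzerodivisor x \<Longrightarrow> nonzerodivisor (x [^] (n::nat))"
proof (induction n)
  case 0
  show ?case by (rule nonzerodivisorI) auto
next
  case (Suc n)
  note x = nonzerodivisor_closed[OF Suc.prems]
  show ?case
  proof (rule nonzerodivisorI)
    fix a assume a: "a \<in> carrier R" "x [^] Suc n \<otimes> a = \<zero>"
    have "x [^] n \<otimes> (x \<otimes> a) = \<zero>" using a x by (simp add: m_assoc)
    then have "x \<otimes> a = \<zero>" using nonzerodivisorD[OF Suc.IH[OF Suc.prems]] a x by blast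
    then show "a = \<zero>" using nonzerodivisorD[OF Suc.prems a(1)] by blast
  qed (use x in simp)
qed

text \<open>Otherwise the products \<open>s x\<^sup>i\<close> with \<open>s\<close> outside \<open>p\<close> form a multiplicative set that avoids \<open>0\<close>, and a prime
  ideal \<open>q\<close> disjoint from it yields the chain \<open>q \<subset> p \<subset> \<mm>\<close>, which is too long for a ring of
  dimension one.\<close>

lemma prime_containing_nonzerodivisor:
  assumes dim: "krull_dim R = 1" and p: "primeideal p R" and x: "x \<in> p" "nonzerodivisor x"
  shows "p = \<mm>"
proof (rule ccontr)
  assume "p \<noteq> \<mm>"
  have ip: "ideal p R" and pn: "carrier R \<noteq> p" using p by (auto simp: primeideal_def primeideal_axioms_def)
  have "p \<subset> \<mm>" using proper_subset_max[OF ip] pn \<open>p \<noteq> \<mm>\<close> by auto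
  have xc: "x \<in> carrier R" using x(2) by (rule nonzerodivisor_closed)
  define S where "S = {s \<otimes> x [^] i |s i. s \<in> carrier R - p \<and> i \<in> (UNIV::nat set)}"
  have pS: "s \<in> S" if "s \<in> carrier R - p" for s
    unfolding S_def using that by (auto intro!: exI[of _ s] exI[of _ "0::nat"])
  have one: "\<one> \<notin> p" using pn ideal.one_imp_carrier[OF ip] by auto
  obtain q where q: "primeideal q R" "q \<inter> S = {}"
  proof (rule exists_prime_disjoint[of S])
    show "S \<subseteq> carrier R" using xc unfolding S_def by auto
    show "\<one> \<in> S" using pS one by auto
    show "\<zero> \<notin> S"
    proof
      assume "\<zero> \<in> S"
      then obtain s i where s: "s \<in> carrier R" "s \<notin> p" and "\<zero> = s \<otimes> x [^] (i::nat)" unfolding S_def by auto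
      then have "x [^] i \<otimes> s = \<zero>" using xc by (simp add: m_comm)
      then have "s = \<zero>" using nonzerodivisorD[OF nonzerodivisor_pow[OF x(2)]] s by blast
      then show False using s ideal_zero[OF ip] by simp
    qed
    fix a b assume "a \<in> S" "b \<in> S"
    then obtain s i t j where st: "s \<in> carrier R" "s \<notin> p" "t \<in> carrier R" "t \<notin> p"
        and ab: "a = s \<otimes> x [^] (i::nat)" "b = t \<otimes> x [^] (j::nat)" unfolding S_def by auto
    have "a \<otimes> b = (s \<otimes> t) \<otimes> (x [^] i \<otimes> x [^] j)"
      unfolding ab using st xc by (simp add: m_assoc m_lcomm)
    also have "\<dots> = (s \<otimes> t) \<otimes> x [^] (i + j)" using xc by (simp add: nat_pow_mult)
    finally have eq: "a \<otimes> b = (s \<otimes> t) \<otimes> x [^] (i + j)" .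
    have "s \<otimes> t \<notin> p" using primeideal.I_prime[OF p] st by blast
    then show "a \<otimes> b \<in> S" unfolding S_def using eq st by blast
  qed
  have "q \<subseteq> p" using pS q(2) ideal_subset[of q] primeideal.axioms(1)[OF q(1)] by blast
  moreover have "x \<notin> q"
  proof -
    have "\<one> \<otimes> x [^] (1::nat) \<in> S" unfolding S_def using one by blast
    then show ?thesis using q(2) xc by auto
  qed
  ultimately have "q \<subset> p" using x by auto
  have "enat 2 \<le> krull_dim R"
    unfolding krull_dim_def
  proof (rule chain_lengthI[where C="\<lambda>i. if i = 0 then q else if i = 1 then p else \<mm>"])
    fix i :: nat assume "i < 2"
    then have "i = 0 \<or> i = 1" by auto
    then show "(if i = 0 then q else if i = 1 then p else \<mm>)
        \<subset> (if Suc i = 0 then q else if Suc i = 1 then p else \<mm>)"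
      using \<open>q \<subset> p\<close> \<open>p \<subset> \<mm>\<close> by auto
  qed (use q p prime_max in auto)
  then show False using dim by (simp add: one_enat_def)
qed

lemma exists_max_pow_subset_scale:
  assumes "krull_dim R = 1" and x: "nonzerodivisor x"
  shows "\<exists>t. max_pow t \<subseteq> x <# carrier R"
proof (rule ccontr)
  assume none: "\<nexists>t. max_pow t \<subseteq> x <# carrier R"
  have xc: "x \<in> carrier R" using x by (rule nonzerodivisor_closed)
  obtain p where p: "primeideal p R" "x <# carrier R \<subseteq> p" "p \<noteq> \<mm>"
    using exists_prime_if_no_max_pow_subset[OF ideal_scale[OF oneideal xc] none] .
  moreover have "x \<in> p" using p(2) mem_scaleI[OF one_closed, of x] xc by auto
  ultimately show False using prime_containing_nonzerodivisor assms by blast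
qed

lemma exists_max_pow_subset_primary:
  assumes "primary_ideal R I" "radical R I = \<mm>"
  shows "\<exists>t. max_pow t \<subseteq> I"
proof (rule ccontr)
  assume none: "\<nexists>t. max_pow t \<subseteq> I"
  have "ideal I R" using assms(1) by (simp add: primary_ideal_def)
  then obtain p where p: "primeideal p R" "I \<subseteq> p" "p \<noteq> \<mm>"
    using exists_prime_if_no_max_pow_subset none by blast
  have ip: "ideal p R" and pn: "carrier R \<noteq> p" using p by (auto simp: primeideal_def primeideal_axioms_def)
  have "a \<in> p" if a: "a \<in> carrier R" and an: "a [^] (n::nat) \<in> p" for a n
    using an
  proof (induction n)
    case 0
    then show ?case using pn ideal.one_imp_carrier[OF ip] by auto
  next
    case (Suc n)
    then show ?case using primeideal.I_prime[OF p(1) _ a] a by auto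
  qed
  then have "\<mm> \<subseteq> p" using assms(2) p(2) unfolding radical_def by auto
  then show False using proper_subset_max[OF ip] pn p(3) by auto
qed

lemma quot_length_finite:
  assumes "max_pow t \<subseteq> J" shows "quot_length J (carrier R) < \<infinity>"
  using quot_length_antimono[OF assms] quot_length_max_pow_finite by (rule order_le_less_trans)

section \<open>Multiplicity\<close>

text \<open>The length of \<open>R/yK\<close> can be computed through \<open>yR\<close> and through \<open>K\<close>; in both cases \<open>R/K\<close> contributes
  its length, once as \<open>yR/yK\<close>.\<close>

lemma quot_length_scale_self:
  assumes K: "ideal K R" and fin: "quot_length K (carrier R) < \<infinity>" and y: "nonzerodivisor y"
  shows "quot_length (y <# K) K = quot_length (y <# carrier R) (carrier R)"
proof -
  have yc: "y \<in> carrier R" using y by (rule nonzerodivisor_closed)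
  have i: "ideal (y <# K) R" "ideal (y <# carrier R) R" using yc K oneideal ideal_scale by auto
  note Kc = ideal_subset[OF K]
  have "quot_length (y <# K) (carrier R) =
      quot_length (y <# K) (y <# carrier R) + quot_length (y <# carrier R) (carrier R)"
    by (intro quot_length_add i oneideal scale_mono Kc ideal_subset)
  also have "quot_length (y <# K) (y <# carrier R) = quot_length K (carrier R)"
    by (rule quot_length_scale_nonzerodivisor[OF K oneideal Kc yc nonzerodivisorD[OF y]])
  finally have "quot_length (y <# K) (carrier R) =
      quot_length K (carrier R) + quot_length (y <# carrier R) (carrier R)" .
  moreover have "quot_length (y <# K) (carrier R) = quot_length (y <# K) K + quot_length K (carrier R)"
    by (intro quot_length_add i K oneideal scale_subset yc Kc)
  ultimately have "quot_length K (carrier R) + quot_length (y <# K) K =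
      quot_length K (carrier R) + quot_length (y <# carrier R) (carrier R)" by (simp add: add.commute)
  then show ?thesis using fin by (auto simp: enat_add_left_cancel)
qed

lemma quot_length_max_pow_Suc_le:
  assumes x: "x \<in> \<mm>" "nonzerodivisor x"
  shows "quot_length (max_pow (Suc n)) (max_pow n) \<le> quot_length (x <# carrier R) (carrier R)"
proof -
  have "x <# max_pow n \<subseteq> max_pow (Suc n)"
    using scale_max_pow_subset[of x 1 n] x(1) max_pow_1 by simp
  then have "quot_length (max_pow (Suc n)) (max_pow n) \<le> quot_length (x <# max_pow n) (max_pow n)"
    by (rule quot_length_antimono)
  also have "\<dots> = quot_length (x <# carrier R) (carrier R)"
    by (intro quot_length_scale_self ideal_max_pow quot_length_max_pow_finite x)
  finally show ?thesis .
qed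

text \<open>From \<open>\<mm>\<^sup>r\<close> on, each quotient of consecutive powers is \<open>\<mm>\<^sup>n/y\<mm>\<^sup>n\<close> and therefore has the length
  of \<open>R/yR\<close>, so the length of \<open>R/\<mm>\<^sup>n\<close> grows linearly with this slope.\<close>

lemma multiplicity_eq_quot_length:
  assumes dim: "krull_dim R = 1" and y: "nonzerodivisor y"
    and red: "max_pow (Suc r) = y <# max_pow r" and e: "quot_length (y <# carrier R) (carrier R) = enat e"
  shows "multiplicity_HS R \<mm> = real e"
proof -
  have yc: "y \<in> carrier R" using y by (rule nonzerodivisor_closed)
  have step: "max_pow (Suc n) = y <# max_pow n" if "n \<ge> r" for n
    using that
  proof (induction n rule: dec_induct)
    case (step n)
    have "max_pow (Suc (Suc n)) = \<mm> \<cdot> (y <# max_pow n)"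
      unfolding max_pow_Suc[of "Suc n"] step.IH ..
    also have "\<dots> = y <# max_pow (Suc n)"
      unfolding max_pow_Suc by (rule scale_prod[OF ideal_max ideal_max_pow yc, symmetric])
    finally show ?case .
  qed (rule red)
  define c where "c n = the_enat (quot_length (max_pow n) (carrier R))" for n
  have c: "quot_length (max_pow n) (carrier R) = enat (c n)" for n
    using quot_length_max_pow_finite[of n] unfolding c_def by (cases "quot_length (max_pow n) (carrier R)") auto
  have "c (Suc n) = c n + e" if "n \<ge> r" for n
  proof -
    have "enat (c (Suc n)) = quot_length (max_pow (Suc n)) (max_pow n) + enat (c n)"
      unfolding c[symmetric] using max_pow_antimono[of n "Suc n"]
      by (intro quot_length_add ideal_max_pow oneideal ideal_subset) auto
    also have "quot_length (max_pow (Suc n)) (max_pow n) = enat e"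
      unfolding step[OF that] e[symmetric]
      by (intro quot_length_scale_self ideal_max_pow quot_length_max_pow_finite y)
    finally show ?thesis by simp
  qed
  note c_Suc = this
  have cn: "c n = c r + (n - r) * e" if "n \<ge> r" for n
    using that by (induction n rule: dec_induct) (auto simp: Suc_diff_le c_Suc)
  have "(\<lambda>n. real e + (real (c r) - real r * real e) / real n) \<longlonglongrightarrow> real e + 0"
    by (intro tendsto_intros lim_const_over_n)
  moreover have "\<forall>\<^sub>F n in sequentially.
      real e + (real (c r) - real r * real e) / real n = real (c n) / real n"
    using eventually_ge_at_top[of "Suc r"]
  proof eventually_elim
    case (elim n)
    have "c n = c r + (n - r) * e" by (rule cn) (use elim in simp)
    then have "real (c n) = real (c r) + (real n - real r) * real e"
      using elim by (simp only: of_nat_add of_nat_mult) (simp add: of_nat_diff)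
    then show ?case using elim by (simp add: field_simps)
  qed
  ultimately have "(\<lambda>n. real (c n) / real n) \<longlonglongrightarrow> real e"
    using Lim_transform_eventually by fastforce
  moreover have "multiplicity_HS R \<mm> = lim (\<lambda>n. real (c n) / real n)"
    unfolding multiplicity_HS_def dim max_pow_def[symmetric] ring_length_Quot[OF ideal_max_pow] c
    by (simp add: one_enat_def)
  ultimately show ?thesis by (simp add: limI)
qed

end

context cohen_macaulay_local_ring
begin

lemma exists_nonzerodivisor:
  assumes "krull_dim R = 1"
  obtains x where "x \<in> \<mm>" "nonzerodivisor x"
proof -
  have "0 < depth R \<mm>" using depth_eq_dim assms by simp
  then obtain xs where xs: "xs \<noteq> []" "set xs \<subseteq> \<mm>" "regular_sequence R xs"
    unfolding depth_def less_Sup_iff by (auto simp: zero_enat_def)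
  have "nonzerodivisor (xs ! 0)"
    using xs unfolding regular_sequence_def
    by (intro nonzerodivisorI) (auto dest!: spec[of _ 0] simp: Idl_empty subset_iff)
  moreover have "xs ! 0 \<in> \<mm>" using xs(1,2) by (auto intro: nth_mem)
  ultimately show thesis using that by blast
qed

text \<open>A nonzerodivisor \<open>x \<in> \<mm>\<close> bounds the dimensions of all \<open>\<mm>\<^sup>n/\<mm>\<^sup>n\<^sup>+\<^sup>1\<close> by the length \<open>b\<close> of \<open>R/xR\<close>. Once
  the exponent exceeds \<open>b\<close> this is the hypothesis of \<open>exists_principal_reduction\<close>. The resulting \<open>y\<close>
  is a nonzerodivisor because it divides a power of \<open>x\<close>.\<close>

lemma exists_multiplicity_element:
  assumes dim: "krull_dim R = 1" and inf: "infinite (carrier (R Quot \<mm>))"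
  obtains y e where "y \<in> \<mm>" "nonzerodivisor y" "quot_length (y <# carrier R) (carrier R) = enat e"
    "multiplicity_HS R \<mm> = real e"
proof -
  obtain x where x: "x \<in> \<mm>" "nonzerodivisor x" using exists_nonzerodivisor[OF dim] .
  have "quot_length (x <# carrier R) (carrier R) < \<infinity>"
    using exists_max_pow_subset_scale[OF dim x(2)] quot_length_finite by blast
  then obtain b where "quot_length (x <# carrier R) (carrier R) = enat b" by auto
  then have "quot_length (max_pow (Suc (Suc b))) (max_pow (Suc b)) \<le> enat (Suc b)"
    by (intro order_trans[OF quot_length_max_pow_Suc_le[OF x]]) simp
  then obtain y where y: "y \<in> \<mm>" "max_pow (Suc b) = y <# max_pow b"
    using exists_principal_reduction[OF inf] by blast
  have yc: "y \<in> carrier R" using y max_subset by auto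
  have "x [^] Suc b \<in> y <# max_pow b" using pow_mem_max_pow[OF x(1), of "Suc b"] y(2) by simp
  then obtain c where c: "c \<in> max_pow b" "x [^] Suc b = y \<otimes> c" by (rule mem_scaleE)
  have cc: "c \<in> carrier R" using ideal.Icarr[OF ideal_max_pow c(1)] .
  have ny: "nonzerodivisor y"
  proof (rule nonzerodivisorI[OF yc])
    fix a assume a: "a \<in> carrier R" "y \<otimes> a = \<zero>"
    have "x [^] Suc b \<otimes> a = c \<otimes> (y \<otimes> a)"
      unfolding c(2) using yc cc a(1) by algebra
    then have "x [^] Suc b \<otimes> a = \<zero>" using a(2) cc by simp
    then show "a = \<zero>" using nonzerodivisorD[OF nonzerodivisor_pow[OF x(2)] a(1)] by blast
  qed
  have "max_pow (Suc b) \<subseteq> y <# carrier R"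
    unfolding y(2) by (intro scale_mono ideal_subset ideal_max_pow)
  then obtain e where "quot_length (y <# carrier R) (carrier R) = enat e"
    using quot_length_finite by force
  then show thesis using that[OF y(1) ny] multiplicity_eq_quot_length[OF dim ny y(2)] by blast
qed

text \<open>The quotient \<open>I/yI\<close> has length \<open>e(R)\<close>, and its quotient \<open>I/\<mm>I\<close> has at least length \<open>\<mu>(I) = e(R)\<close>, which
  leaves no room between \<open>yI\<close> and \<open>\<mm>I\<close>.\<close>

lemma ulrich_ideal_max_prod:
  assumes I: "ulrich_ideal R \<mm> I" and y: "y \<in> \<mm>" "nonzerodivisor y"
    and e: "quot_length (y <# carrier R) (carrier R) = enat e" "multiplicity_HS R \<mm> = real e"
  shows "\<mm> \<cdot> I = y <# I"
proof (rule ccontr)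
  assume ne: "\<mm> \<cdot> I \<noteq> y <# I"
  have iI: "ideal I R" and gens: "min_generators R I = e"
    using I e by (auto simp: ulrich_ideal_def primary_ideal_def)
  have yc: "y \<in> carrier R" using y max_subset by auto
  have mI: "ideal (\<mm> \<cdot> I) R" "\<mm> \<cdot> I \<subseteq> I"
    using ideal_prod_is_ideal[OF ideal_max iI] ideal_prod_inter[OF ideal_max iI] by auto
  have yI: "ideal (y <# I) R" "y <# I \<subseteq> \<mm> \<cdot> I"
    using ideal_scale[OF iI yc] y(1) by (auto elim!: mem_scaleE intro: ideal_prod.prod)
  have fin: "quot_length I (carrier R) < \<infinity>"
    using exists_max_pow_subset_primary I quot_length_finite unfolding ulrich_ideal_def by blast
  have "y <# I \<subset> \<mm> \<cdot> I" using ne yI by auto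
  then have "quot_length (y <# I) (y <# I) + 1 \<le> quot_length (y <# I) (\<mm> \<cdot> I)"
    by (intro quot_length_psubset yI mI) auto
  then have "1 \<le> quot_length (y <# I) (\<mm> \<cdot> I)" by (meson add_increasing order_trans zero_le order_refl)
  moreover have "enat e \<le> quot_length (\<mm> \<cdot> I) I"
    using min_generators_le[OF iI] gens by simp
  ultimately have "1 + enat e \<le> quot_length (y <# I) (\<mm> \<cdot> I) + quot_length (\<mm> \<cdot> I) I"
    by (rule add_mono)
  also have "\<dots> = quot_length (y <# I) I"
    using quot_length_add[OF yI(1) mI(1) iI yI(2) mI(2)] by simp
  also have "\<dots> = enat e" using quot_length_scale_self[OF iI fin y(2)] e(1) by simp
  finally show False by (simp add: one_enat_def)
qed

text \<open>If \<open>\<mm>(I : \<mm>) = \<mm>I = yI\<close>, then cancelling \<open>y\<close> from \<open>y(I : \<mm>) \<subseteq> yI\<close> gives \<open>I : \<mm> = I\<close>.\<close>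

lemma burch_ideal_if_max_prod_principal:
  assumes I: "ideal I R" and y: "y \<in> \<mm>" "nonzerodivisor y" and eq: "\<mm> \<cdot> I = y <# I"
    and "I \<noteq> colon_ideal R I \<mm>"
  shows "burch_ideal R \<mm> I"
  unfolding burch_ideal_def
proof (intro conjI I notI)
  assume mm: "\<mm> \<cdot> I = \<mm> \<cdot> colon_ideal R I \<mm>"
  have yc: "y \<in> carrier R" using y max_subset by auto
  have "colon_ideal R I \<mm> \<subseteq> I"
  proof
    fix a assume a: "a \<in> colon_ideal R I \<mm>"
    then have ac: "a \<in> carrier R" by (simp add: colon_ideal_def)
    have "y \<otimes> a \<in> y <# I" using ideal_prod.prod[OF y(1) a, of R] mm eq by simp
    then obtain i where i: "i \<in> I" "y \<otimes> a = y \<otimes> i" by (rule mem_scaleE)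
    have ic: "i \<in> carrier R" using ideal.Icarr[OF I i(1)] .
    have "y \<otimes> (a \<ominus> i) = y \<otimes> a \<ominus> y \<otimes> i" using yc ac ic by algebra
    then have "y \<otimes> (a \<ominus> i) = \<zero>" using i(2) yc ic by simp
    then have "a \<ominus> i = \<zero>" using nonzerodivisorD[OF y(2)] ac ic by simp
    then show "a \<in> I" using ac ic i(1) by simp
  qed
  moreover have "I \<subseteq> colon_ideal R I \<mm>"
    using ideal.Icarr[OF I] ideal.I_r_closed[OF I] max_subset by (auto simp: colon_ideal_def)
  ultimately show False using assms(5) by blast
qed

end

theorem proposition3p19:
  fixes R :: "('a, 'b) ring_scheme" and \<mm> I :: "'a set"
  assumes "cohen_macaulay_local_ring R \<mm>"
    and "krull_dim R = 1"
    and "infinite (carrier (R Quot \<mm>))"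
    and "ulrich_ideal R \<mm> I"
    and "I \<cdot>\<^bsub>R\<^esub> I \<noteq> I \<cdot>\<^bsub>R\<^esub> colon_ideal R I \<mm>"
  shows "burch_ideal R \<mm> I"
proof -
  interpret cohen_macaulay_local_ring R \<mm> by fact
  obtain y e where y: "y \<in> \<mm>" "nonzerodivisor y"
    and e: "quot_length (y <#\<^bsub>R\<^esub> carrier R) (carrier R) = enat e" "multiplicity_HS R \<mm> = real e"
    using exists_multiplicity_element[OF assms(2,3)] .
  have "\<mm> \<cdot>\<^bsub>R\<^esub> I = y <#\<^bsub>R\<^esub> I"
    using assms(4) y e by (rule ulrich_ideal_max_prod)
  moreover have "ideal I R" using assms(4) by (simp add: ulrich_ideal_def primary_ideal_def)
  moreover have "I \<noteq> colon_ideal R I \<mm>" using assms(5) by metis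
  ultimately show ?thesis using y by (intro burch_ideal_if_max_prod_principal)
qed

end
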